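(* Let $n>6$ and $2(n-2)<m<3(n-3)$ be integers, and let $G$ be a bipartite optimal graph in $\mathfrak{B}_{n,m}$. Then $G$ is a difference graph, and its vertex-eigenvector $w$ (with the partite sets labeled so that $\sum_i x_i\ge\sum_i y_i$) satisfies $$w=\begin{cases}(m-2n+6,\,3n-m-9;\,2,1), & \text{if } m<\frac{7n}{3}-7;\\ (\frac{n-3}{3},\frac{2n-6}{3};\,2,1)\ \text{or}\ (\frac{2n-6}{3},\frac{n-3}{3};\,1,2), & \text{if } m=\frac{7n}{3}-7;\\ (\frac{m-n+3}{2},\frac{3n-m-9}{2};\,1,2), & \text{if } m>\frac{7n}{3}-7 \text{ and } 3n-m-9 \text{ is even};\\ (\frac{m-n+2}{2},\,1,\,\frac{3n-m-10}{2};\,1,1,1), & \text{if } m>\frac{7n}{3}-7 \text{ and } 3n-m-9 \text{ is odd}.\end{cases}$$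
   Context: All graphs are finite, simple and undirected. For a graph $G$ on $n$ vertices with adjacency matrix $\mathbf{A}(G)$, write $\det(\lambda I-\mathbf{A}(G))=\sum_{i=0}^n \mathbf{a}_i(G)\lambda^{n-i}$, so $\mathbf{a}_4(G)$ is the coefficient of $\lambda^{n-4}$. $\mathfrak{B}_{n,m}$ is the set of connected bipartite graphs with $n$ vertices and $m$ edges; $G\in\mathfrak{B}_{n,m}$ is bipartite optimal if $\mathbf{a}_4(G)=\min\{\mathbf{a}_4(H):H\in\mathfrak{B}_{n,m}\}$. A difference graph is a bipartite graph in which the neighborhoods of the vertices of one partite set are linearly ordered by inclusion. A connected difference graph has a vertex bipartition $(X_1,\ldots,X_k;Y_1,\ldots,Y_k)$: its vertex set is the disjoint union of nonempty sets $X_1,\ldots,X_k,Y_1,\ldots,Y_k$, with $X=\bigcup X_i$, $Y=\bigcup Y_j$ the partite sets, and $x\in X_i$, $y\in Y_j$ adjacent if and only if $i+j\le k+1$. Its vertex-eigenvector is $(x_1,\ldots,x_k;y_1,\ldots,y_k)$ with $x_i=|X_i|$, $y_i=|Y_i|$.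
   Formalization: The fourth case is corrected for two values of m: if 3m=7n-20 the vector is (m-2n+6, 3n-m-9; 2,1), as the stated one is not optimal (n=11, m=19: a_4 is 32 against 30); if m=3n-10 the stated vector has a zero entry and is replaced by (n-4,1;2,1). *)

theory Defs
  imports "Graph_Theory.Graph_Theory" "Jordan_Normal_Form.Char_Poly"
begin

text \<open>
  A finite simple undirected graph is a \<open>pair_graph\<close>: a finite loop-free digraph whose arc set is
  symmetric. Every undirected edge \<open>{u, v}\<close> is represented by the two arcs \<open>(u, v)\<close> and \<open>(v, u)\<close>.
\<close>

definition edge_set :: "'a pair_pre_digraph \<Rightarrow> 'a set set" where
  "edge_set G = {{u, v} |u v. (u, v) \<in> parcs G}"

definition nbhd :: "'a pair_pre_digraph \<Rightarrow> 'a \<Rightarrow> 'a set" where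
  "nbhd G v = {u. (v, u) \<in> parcs G}"

definition adj_mat :: "'a pair_pre_digraph \<Rightarrow> 'a list \<Rightarrow> real mat" where
  "adj_mat G vs = mat (length vs) (length vs)
     (\<lambda>(i, j). if (vs ! i, vs ! j) \<in> parcs G then 1 else 0)"

text \<open>
  The characteristic polynomial does not depend on the order in which the vertices are listed, so
  an arbitrary listing is chosen.
\<close>

definition graph_char_poly :: "'a pair_pre_digraph \<Rightarrow> real poly" where
  "graph_char_poly G =
     char_poly (adj_mat G (SOME vs. distinct vs \<and> set vs = pverts G))"

text \<open>
  \<open>acoeff i G\<close> is the coefficient of \<open>\<lambda> ^ (n - i)\<close> in the characteristic polynomial; the
  truncated subtraction makes it meaningful only for \<open>i \<le> n\<close>.
\<close>

definition acoeff :: "nat \<Rightarrow> 'a pair_pre_digraph \<Rightarrow> real" where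
  "acoeff i G = coeff (graph_char_poly G) (card (pverts G) - i)"

definition bipartition :: "'a pair_pre_digraph \<Rightarrow> 'a set \<Rightarrow> 'a set \<Rightarrow> bool" where
  "bipartition G X Y \<longleftrightarrow> X \<union> Y = pverts G \<and> X \<inter> Y = {} \<and>
     (\<forall>(u, v) \<in> parcs G. u \<in> X \<and> v \<in> Y \<or> u \<in> Y \<and> v \<in> X)"

definition bipartite :: "'a pair_pre_digraph \<Rightarrow> bool" where
  "bipartite G \<longleftrightarrow> (\<exists>X Y. bipartition G X Y)"

text \<open>
  The vertices are drawn from the type \<open>'a\<close>. As soon as this type has \<open>n\<close> elements, every graph
  with \<open>n\<close> vertices has an isomorphic copy over it.
\<close>

definition conn_bipartite_graphs :: "nat \<Rightarrow> nat \<Rightarrow> 'a pair_pre_digraph set" where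
  "conn_bipartite_graphs n m =
     {G. pair_graph G \<and> connected (with_proj G) \<and> bipartite G \<and>
         card (pverts G) = n \<and> card (edge_set G) = m}"

definition bipartite_optimal :: "nat \<Rightarrow> nat \<Rightarrow> 'a pair_pre_digraph \<Rightarrow> bool" where
  "bipartite_optimal n m G \<longleftrightarrow> G \<in> conn_bipartite_graphs n m \<and>
     (\<forall>H \<in> (conn_bipartite_graphs n m :: 'a pair_pre_digraph set). acoeff 4 G \<le> acoeff 4 H)"

definition difference_graph :: "'a pair_pre_digraph \<Rightarrow> bool" where
  "difference_graph G \<longleftrightarrow> pair_graph G \<and>
     (\<exists>X Y. bipartition G X Y \<and>
        (\<forall>u\<in>X. \<forall>v\<in>X. nbhd G u \<subseteq> nbhd G v \<or> nbhd G v \<subseteq> nbhd G u))"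

definition vertex_bipartition ::
  "'a pair_pre_digraph \<Rightarrow> nat \<Rightarrow> (nat \<Rightarrow> 'a set) \<Rightarrow> (nat \<Rightarrow> 'a set) \<Rightarrow> bool" where
  "vertex_bipartition G k X Y \<longleftrightarrow>
     (\<forall>i\<in>{1..k}. X i \<noteq> {} \<and> Y i \<noteq> {}) \<and>
     disjoint_family_on X {1..k} \<and> disjoint_family_on Y {1..k} \<and>
     bipartition G (\<Union>i\<in>{1..k}. X i) (\<Union>j\<in>{1..k}. Y j) \<and>
     (\<forall>i\<in>{1..k}. \<forall>j\<in>{1..k}. \<forall>x\<in>X i. \<forall>y\<in>Y j. (x, y) \<in> parcs G \<longleftrightarrow> i + j \<le> k + 1)"

definition vertex_eigenvector :: "'a pair_pre_digraph \<Rightarrow> nat list \<Rightarrow> nat list \<Rightarrow> bool" where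
  "vertex_eigenvector G xs ys \<longleftrightarrow>
     (\<exists>k X Y. vertex_bipartition G k X Y \<and>
        xs = map (\<lambda>i. card (X i)) [1..<k + 1] \<and> ys = map (\<lambda>i. card (Y i)) [1..<k + 1])"

text \<open>
  \<open>optimal_vector n m xs ys\<close> says that \<open>(xs; ys)\<close> is the vector \<open>w\<close> belonging to \<open>n\<close> and \<open>m\<close>.
  The first four conjuncts are the generic formulas. The formula of the odd case has to be replaced
  for two values of \<open>m\<close>; these replacements, the last two conjuncts, are corrections to the
  published table, which applies the formula to all odd cases.

  For \<open>3 * m = 7 * n - 20\<close> (so \<open>3 * n - m - 9\<close> is odd and \<open>m\<close> exceeds \<open>7 * n / 3 - 7\<close> by
  \<open>1 / 3\<close>), the formula of the odd case does not give the minimum; the formula of the first case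
  does. The smallest instance is \<open>n = 11\<close>, \<open>m = 19\<close>: there \<open>(3, 5; 2, 1)\<close> has fourth
  coefficient 30, whereas \<open>(5, 1, 2; 1, 1, 1)\<close> has 32.

  For \<open>m = 3 * n - 10\<close>, the formula of the odd case reads \<open>(n - 4, 1, 0; 1, 1, 1)\<close>. The third
  block on the left is empty, so the first two blocks on the right have the same neighbours and
  merge; with nonempty blocks the same graph has the vector \<open>(n - 4, 1; 2, 1)\<close>.
\<close>

definition optimal_vector :: "nat \<Rightarrow> nat \<Rightarrow> real list \<Rightarrow> real list \<Rightarrow> bool" where
  "optimal_vector n m xs ys \<longleftrightarrow>
     (let N = real n; M = real m; t = 7 * N / 3 - 7;
          even_case = even (3 * int n - int m - 9)
      in
        (M < t \<longrightarrow>
           xs = [M - 2 * N + 6, 3 * N - M - 9] \<and> ys = [2, 1]) \<and>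
        (M = t \<longrightarrow>
           xs = [(N - 3) / 3, (2 * N - 6) / 3] \<and> ys = [2, 1] \<or>
           xs = [(2 * N - 6) / 3, (N - 3) / 3] \<and> ys = [1, 2]) \<and>
        (M > t \<and> even_case \<longrightarrow>
           xs = [(M - N + 3) / 2, (3 * N - M - 9) / 2] \<and> ys = [1, 2]) \<and>
        (M > t \<and> \<not> even_case \<and> 3 * M \<noteq> 7 * N - 20 \<and> M \<noteq> 3 * N - 10 \<longrightarrow>
           xs = [(M - N + 2) / 2, 1, (3 * N - M - 10) / 2] \<and> ys = [1, 1, 1]) \<and>
        (3 * M = 7 * N - 20 \<longrightarrow>
           xs = [M - 2 * N + 6, 3 * N - M - 9] \<and> ys = [2, 1]) \<and>
        (M = 3 * N - 10 \<longrightarrow>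
           xs = [N - 4, 1] \<and> ys = [2, 1]))"

end

theory Submission
  imports Defs "Jordan_Normal_Form.Schur_Decomposition"
begin

text \<open>
  By Newton's identities, \<open>2 a\<^sub>4 = m\<^sup>2 - S\<close> for a bipartite graph, where \<open>S\<close> is the sum of the
  squared codegrees over the ordered pairs of vertices, equal or not, of one side. Optimal graphs are those that maximise
  \<open>S\<close>. Replacing two incomparable neighbourhoods by their union and intersection raises \<open>S\<close>, so an
  optimal graph is nested and is given by its column heights \<open>c\<close>, with \<open>S\<close> the sum of
  \<open>min(c, c')\<^sup>2\<close>.

  Let \<open>p \<ge> q\<close> be the sizes of the sides and suppose \<open>q \<ge> 4\<close>. If the lowest column has height at
  most the number of full columns, it can be turned into a row, which raises \<open>S\<close>. Otherwise the
  number of edges forces at most two full columns, and convexity shows that one of two explicit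
  diagrams with three columns does better. Hence \<open>q = 3\<close>, and there \<open>S\<close> is a convex quadratic
  function of one parameter, so that the two ends of its range have to be compared.
\<close>

section \<open>The fourth coefficient of the characteristic polynomial\<close>

text \<open>Put \<open>p = n - 3\<close> and \<open>w = m - 2 * p\<close>; the hypotheses on
  \<open>m\<close> become \<open>3 <= w < p\<close>. A diagram with three columns has heights
  \<open>p, a, b\<close> with \<open>a + b = p + w\<close>, and the ends of its range are
  \<open>{p, p, w}\<close> and the most even split of \<open>p + w\<close>. For even
  \<open>p + w\<close> the value of \<open>S\<close> at the second end exceeds that at the first by
  \<open>(p - w) * (3 * w - p)\<close>, hence the threshold \<open>m = 7 n / 3 - 7\<close>, which is
  \<open>3 * w = p\<close>. For odd \<open>p + w\<close> the two lower heights must differ by 1,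
  which costs \<open>p + w - 2\<close> and changes the difference to
  \<open>(p - w - 1) * (3 * w - p - 2)\<close>. This explains the two corrected values: at
  \<open>3 * w = p + 1\<close> the product is not positive although the threshold has been passed,
  and at \<open>w = p - 1\<close> it vanishes because both ends are the same diagram.\<close>

definition mat_trace :: "'a :: comm_monoid_add mat \<Rightarrow> 'a" where
  "mat_trace A = (\<Sum>i<dim_row A. A $$ (i, i))"

lemma mat_trace_mult:
  assumes "A \<in> carrier_mat n n" "B \<in> carrier_mat n n"
  shows "mat_trace (A * B) = (\<Sum>i<n. \<Sum>j<n. A $$ (i, j) * B $$ (j, i))"
  using assms by (auto simp: mat_trace_def scalar_prod_def atLeast0LessThan intro!: sum.cong)

lemma mat_trace_comm:
  fixes A B :: "'a :: comm_semiring_0 mat"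
  assumes "A \<in> carrier_mat n n" "B \<in> carrier_mat n n"
  shows "mat_trace (A * B) = mat_trace (B * A)"
  unfolding mat_trace_mult[OF assms] mat_trace_mult[OF assms(2,1)]
  by (subst sum.swap) (simp add: mult.commute)

lemma mat_trace_similar:
  fixes A B :: "'a :: comm_ring_1 mat"
  assumes "similar_mat_wit A B P Q"
  shows "mat_trace A = mat_trace B"
proof -
  define n where "n = dim_row A"
  note D = similar_mat_witD[OF n_def assms]
  have "mat_trace A = mat_trace (P * (B * Q))"
    using D by (simp add: assoc_mult_mat[of _ n n _ n _ n])
  also have "\<dots> = mat_trace ((B * Q) * P)"
    by (rule mat_trace_comm[of _ n]) (use D in auto)
  also have "(B * Q) * P = B"
    using D by (simp add: assoc_mult_mat[of _ n n _ n _ n])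
  finally show ?thesis .
qed

lemma upper_triangular_mult:
  fixes A B :: "'a :: semiring_0 mat"
  assumes A: "A \<in> carrier_mat n n" "upper_triangular A"
    and B: "B \<in> carrier_mat n n" "upper_triangular B"
  shows "upper_triangular (A * B)"
    and "i < n \<Longrightarrow> (A * B) $$ (i, i) = A $$ (i, i) * B $$ (i, i)"
proof -
  have *: "A $$ (i, k) * B $$ (k, j) = 0" if "j \<le> i" "i < n" "k < n" "\<not> (k = i \<and> j = i)" for i j k
    using that A B upper_triangularD[of A k i] upper_triangularD[of B j k]
    by (cases "k < i") auto
  show "upper_triangular (A * B)"
    by (rule upper_triangularI) (use A B in \<open>auto simp: scalar_prod_def intro!: sum.neutral *\<close>)
  show "(A * B) $$ (i, i) = A $$ (i, i) * B $$ (i, i)" if "i < n"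
  proof -
    have "(A * B) $$ (i, i) = (\<Sum>k\<in>{0..<n}. A $$ (i, k) * B $$ (k, i))"
      using that A B by (simp add: scalar_prod_def)
    also have "\<dots> = (\<Sum>k\<in>{i}. A $$ (i, k) * B $$ (k, i))"
      using that by (intro sum.mono_neutral_right) (auto intro!: *)
    finally show ?thesis by simp
  qed
qed

lemma upper_triangular_pow:
  fixes B :: "'a :: semiring_1 mat"
  assumes "B \<in> carrier_mat n n" "upper_triangular B"
  shows "upper_triangular (B ^\<^sub>m k) \<and> (\<forall>i<n. (B ^\<^sub>m k) $$ (i, i) = B $$ (i, i) ^ k)"
proof (induction k)
  case 0
  then show ?case using assms by (auto simp: one_mat_def)
next
  case (Suc k)
  then show ?case
    using upper_triangular_mult[of "B ^\<^sub>m k" n B] assms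
    by (auto simp: power_commutes)
qed

text \<open>A Schur decomposition makes the matrix similar to an upper triangular one with diagonal
  \<open>es\<close>; powers keep this form, and similarity keeps the trace.\<close>

lemma trace_pow_eq_power_sum:
  fixes A :: "complex mat"
  assumes A: "A \<in> carrier_mat n n" and c: "char_poly A = (\<Prod>e\<leftarrow>es. [:- e, 1:])"
  shows "mat_trace (A ^\<^sub>m k) = (\<Sum>e\<leftarrow>es. e ^ k)"
proof -
  obtain B P Q where "schur_decomposition A es = (B, P, Q)"
    by (cases "schur_decomposition A es") auto
  from schur_decomposition[OF A c this] have
    w: "similar_mat_wit A B P Q" and ut: "upper_triangular B" and d: "diag_mat B = es" by auto
  have B: "B \<in> carrier_mat n n" using similar_mat_witD2[OF A w] by auto
  have es: "es = map (\<lambda>i. B $$ (i, i)) [0..<n]" using d B by (simp add: diag_mat_def)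
  have "mat_trace (A ^\<^sub>m k) = mat_trace (B ^\<^sub>m k)"
    by (rule mat_trace_similar[OF similar_mat_wit_pow[OF w]])
  also have "\<dots> = (\<Sum>i<n. B $$ (i, i) ^ k)"
    using upper_triangular_pow[OF B ut] B by (simp add: mat_trace_def)
  also have "\<dots> = (\<Sum>e\<leftarrow>es. e ^ k)"
    by (simp add: es comp_def interv_sum_list_conv_sum_set_nat atLeast0LessThan)
  finally show ?thesis .
qed

section \<open>Elementary symmetric functions and Newton's identities\<close>

lemma coeff_prod_linear_Cons:
  fixes e :: "'a :: idom"
  shows "coeff (\<Prod>e\<leftarrow>(e # es). [:- e, 1:]) (Suc k) =
    coeff (\<Prod>e\<leftarrow>es. [:- e, 1:]) k - e * coeff (\<Prod>e\<leftarrow>es. [:- e, 1:]) (Suc k)"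
  by (simp add: mult_pCons_left coeff_pCons_Suc)

fun esym :: "nat \<Rightarrow> 'a :: comm_ring_1 list \<Rightarrow> 'a" where
  "esym 0 es = 1"
| "esym (Suc k) [] = 0"
| "esym (Suc k) (e # es) = esym (Suc k) es + e * esym k es"

lemma esym_eq_0: "length es < k \<Longrightarrow> esym k es = 0"
  by (induction k es rule: esym.induct) auto

lemma coeff_prod_linear:
  fixes es :: "'a :: idom list"
  shows "k \<le> length es \<Longrightarrow>
    coeff (\<Prod>e\<leftarrow>es. [:- e, 1:]) (length es - k) = (- 1) ^ k * esym k es"
proof (induction k es rule: esym.induct)
  case (1 es)
  then show ?case
    using degree_linear_factors[of uminus es] monic_prod_list[of "map (\<lambda>e. [:- e, 1:]) es"]
    by (force simp: comp_def)
next
  case (2 k)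
  then show ?case by simp
next
  case (3 k e es)
  show ?case
  \<comment> \<open>For \<open>k = length es\<close> the constant coefficient is meant, which
    \<open>coeff_prod_linear_Cons\<close> does not reach; there \<open>esym (Suc k) es\<close>
    vanishes.\<close>
  proof (cases "k = length es")
    case True
    then show ?thesis using 3(2)
      by (simp add: esym_eq_0)
  next
    case False
    then have "k < length es" using 3(3) by simp
    then obtain j where j: "length es - k = Suc j" by (metis Suc_diff_Suc)
    then have "length es - Suc k = j" by simp
    then show ?thesis
      using 3(1) 3(2) j \<open>k < length es\<close> coeff_prod_linear_Cons[of e es j]
      by (simp add: algebra_simps)
  qed
qed

text \<open>One induction serves all four identities, since from degree 2 on the step also needs the
  identity one degree lower. The factors 2, 6, 24 avoid division.\<close>

lemma newton_esym:
  fixes es :: "'a :: comm_ring_1 list"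
  shows newton_esym1: "esym 1 es = (\<Sum>e\<leftarrow>es. e ^ 1)"
    and newton_esym2: "2 * esym 2 es = (\<Sum>e\<leftarrow>es. e ^ 1) ^ 2 - (\<Sum>e\<leftarrow>es. e ^ 2)"
    and newton_esym3: "6 * esym 3 es =
      (\<Sum>e\<leftarrow>es. e ^ 1) ^ 3 - 3 * (\<Sum>e\<leftarrow>es. e ^ 1) * (\<Sum>e\<leftarrow>es. e ^ 2) + 2 * (\<Sum>e\<leftarrow>es. e ^ 3)"
    and newton_esym4: "24 * esym 4 es =
      (\<Sum>e\<leftarrow>es. e ^ 1) ^ 4 - 6 * (\<Sum>e\<leftarrow>es. e ^ 1) ^ 2 * (\<Sum>e\<leftarrow>es. e ^ 2) + 3 * (\<Sum>e\<leftarrow>es. e ^ 2) ^ 2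
      + 8 * (\<Sum>e\<leftarrow>es. e ^ 1) * (\<Sum>e\<leftarrow>es. e ^ 3) - 6 * (\<Sum>e\<leftarrow>es. e ^ 4)"
proof (induction es)
  case Nil
  {
    case 1 show ?case by (simp add: numeral_eq_Suc)
  next
    case 2 show ?case by (simp add: numeral_eq_Suc)
  next
    case 3 show ?case by (simp add: numeral_eq_Suc)
  next
    case 4 show ?case by (simp add: numeral_eq_Suc)
  }
next
  case (Cons e es)
  have rec: "esym 1 (e # es) = esym 1 es + e" "esym 2 (e # es) = esym 2 es + e * esym 1 es"
    "esym 3 (e # es) = esym 3 es + e * esym 2 es" "esym 4 (e # es) = esym 4 es + e * esym 3 es"
    by (simp_all add: numeral_eq_Suc)
  define q where "q k = (\<Sum>e\<leftarrow>es. e ^ k)" for k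
  have q: "(\<Sum>x\<leftarrow>e # es. x ^ k) = e ^ k + q k" for k by (simp add: q_def)
  note IH = Cons[folded q_def]
  {
    case 1 show ?case using IH(1) unfolding rec q by simp
  next
    case 2
    have "2 * (esym 2 es + e * esym 1 es) = 2 * esym 2 es + 2 * e * esym 1 es"
      by (simp add: algebra_simps)
    then show ?case unfolding rec q IH by (simp add: algebra_simps power2_eq_square)
  next
    case 3
    have "6 * (esym 3 es + e * esym 2 es) = 6 * esym 3 es + 3 * e * (2 * esym 2 es)"
      by (simp add: algebra_simps)
    then show ?case unfolding rec q IH by (simp add: algebra_simps power2_eq_square power3_eq_cube)
  next
    case 4
    have "24 * (esym 4 es + e * esym 3 es) = 24 * esym 4 es + 4 * e * (6 * esym 3 es)"
      by (simp add: algebra_simps)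
    then show ?case unfolding rec q IH
      by (simp add: algebra_simps power2_eq_square power3_eq_cube power4_eq_xxxx)
  }
qed

text \<open>The first and third power sums of the eigenvalues vanish, so Newton's identity of degree
  4 keeps only the terms in the second and fourth.\<close>

lemma coeff4_char_poly:
  fixes A :: "real mat"
  assumes A: "A \<in> carrier_mat n n" and n: "4 \<le> n"
    and t1: "mat_trace A = 0" and t3: "mat_trace (A ^\<^sub>m 3) = 0"
  shows "8 * coeff (char_poly A) (n - 4) = mat_trace (A ^\<^sub>m 2) ^ 2 - 2 * mat_trace (A ^\<^sub>m 4)"
proof -
  let ?C = "map_mat complex_of_real A"
  have C: "?C \<in> carrier_mat n n" using A by simp
  obtain es where es: "char_poly ?C = (\<Prod>e\<leftarrow>es. [:- e, 1:])" "length es = n"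
    using char_poly_factorized[OF C] by blast
  have pow: "mat_trace (?C ^\<^sub>m k) = complex_of_real (mat_trace (A ^\<^sub>m k))" for k
    using A by (simp add: of_real_hom.mat_hom_pow[OF A, symmetric] mat_trace_def)
  have ps: "(\<Sum>e\<leftarrow>es. e ^ k) = complex_of_real (mat_trace (A ^\<^sub>m k))" for k
    using trace_pow_eq_power_sum[OF C es(1), of k] pow by simp
  have p1: "(\<Sum>e\<leftarrow>es. e ^ 1) = 0" using ps[of 1] t1 A by simp
  have "complex_of_real (coeff (char_poly A) (n - 4)) = coeff (char_poly ?C) (n - 4)"
    by (simp add: of_real_hom.char_poly_hom[OF A])
  also have "\<dots> = esym 4 es"
    using coeff_prod_linear[of 4 es] es n by simp
  finally have c: "esym 4 es = complex_of_real (coeff (char_poly A) (n - 4))" ..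
  have "24 * complex_of_real (coeff (char_poly A) (n - 4)) =
    complex_of_real (3 * mat_trace (A ^\<^sub>m 2) ^ 2 - 6 * mat_trace (A ^\<^sub>m 4))"
    using newton_esym4[of es] unfolding p1 c ps t3 by simp
  then have "complex_of_real (24 * coeff (char_poly A) (n - 4)) =
    complex_of_real (3 * mat_trace (A ^\<^sub>m 2) ^ 2 - 6 * mat_trace (A ^\<^sub>m 4))"
    by simp
  then have "24 * coeff (char_poly A) (n - 4) = 3 * mat_trace (A ^\<^sub>m 2) ^ 2 - 6 * mat_trace (A ^\<^sub>m 4)"
    unfolding of_real_eq_iff .
  then show ?thesis by simp
qed

section \<open>Bipartite graphs\<close>

text \<open>\<open>E\<close> lists every edge once, directed from \<open>X\<close> to
  \<open>Y\<close>; exchanging the sides amounts to taking the converse.\<close>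

definition bip :: "'a set \<Rightarrow> 'a set \<Rightarrow> ('a \<times> 'a) set \<Rightarrow> 'a pair_pre_digraph" where
  "bip X Y E = \<lparr>pverts = X \<union> Y, parcs = E \<union> E\<inverse>\<rparr>"

definition codeg2 :: "'a set \<Rightarrow> ('a \<times> 'b) set \<Rightarrow> nat" where
  "codeg2 X E = (\<Sum>x\<in>X. \<Sum>x'\<in>X. (card (E `` {x} \<inter> E `` {x'}))\<^sup>2)"

text \<open>Both sums count the quadruples \<open>(x, x', y, y')\<close>, repetitions allowed, with
  all four pairs in \<open>E\<close>: squaring a codegree chooses \<open>y\<close> and
  \<open>y'\<close> independently.\<close>

lemma codeg2_converse:
  assumes "finite X" "finite Y" "E \<subseteq> X \<times> Y"
  shows "codeg2 Y (E\<inverse>) = codeg2 X E"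
proof -
  define b :: "'a \<Rightarrow> 'b \<Rightarrow> nat" where "b x y = of_bool ((x, y) \<in> E)" for x y
  have 1: "card (E `` {x} \<inter> E `` {x'}) = (\<Sum>y\<in>Y. b x y * b x' y)" for x x'
  proof -
    have "E `` {x} \<inter> E `` {x'} = {y \<in> Y. (x, y) \<in> E \<and> (x', y) \<in> E}" using assms by auto
    then show ?thesis using assms(2)
      by (simp add: b_def of_bool_conj[symmetric] Int_def)
  qed
  have 2: "card (E\<inverse> `` {y} \<inter> E\<inverse> `` {y'}) = (\<Sum>x\<in>X. b x y * b x y')" for y y'
  proof -
    have "E\<inverse> `` {y} \<inter> E\<inverse> `` {y'} = {x \<in> X. (x, y) \<in> E \<and> (x, y') \<in> E}" using assms by auto
    then show ?thesis using assms(1)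
      by (simp add: b_def of_bool_conj[symmetric] Int_def)
  qed
  have "codeg2 Y (E\<inverse>) = (\<Sum>y\<in>Y. \<Sum>y'\<in>Y. \<Sum>x\<in>X. \<Sum>x'\<in>X. b x y * b x y' * (b x' y * b x' y'))"
    unfolding codeg2_def 2 power2_eq_square sum_product ..
  also have "\<dots> = (\<Sum>y\<in>Y. \<Sum>x\<in>X. \<Sum>y'\<in>Y. \<Sum>x'\<in>X. b x y * b x y' * (b x' y * b x' y'))"
    by (intro sum.cong refl sum.swap)
  also have "\<dots> = (\<Sum>x\<in>X. \<Sum>y\<in>Y. \<Sum>y'\<in>Y. \<Sum>x'\<in>X. b x y * b x y' * (b x' y * b x' y'))"
    by (rule sum.swap)
  also have "\<dots> = (\<Sum>x\<in>X. \<Sum>y\<in>Y. \<Sum>x'\<in>X. \<Sum>y'\<in>Y. b x y * b x y' * (b x' y * b x' y'))"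
    by (intro sum.cong refl sum.swap)
  also have "\<dots> = (\<Sum>x\<in>X. \<Sum>x'\<in>X. \<Sum>y\<in>Y. \<Sum>y'\<in>Y. b x y * b x y' * (b x' y * b x' y'))"
    by (intro sum.cong refl sum.swap)
  also have "\<dots> = codeg2 X E"
    unfolding codeg2_def 1 power2_eq_square sum_product
    by (intro sum.cong refl) (simp only: mult_ac)
  finally show ?thesis .
qed

section \<open>Traces of powers of the adjacency matrix\<close>

lemma sum_nth_distinct:
  assumes "distinct vs"
  shows "(\<Sum>i<length vs. f (vs ! i)) = (\<Sum>v\<in>set vs. f v)"
  using sum.reindex_bij_betw[OF bij_betw_nth[OF assms refl refl], of f] .

context
  fixes G :: "'a pair_pre_digraph" and vs :: "'a list"
  assumes vs: "distinct vs" and P: "parcs G \<subseteq> set vs \<times> set vs" and sym: "sym (parcs G)"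
begin

lemma adj_mat_carrier: "adj_mat G vs \<in> carrier_mat (length vs) (length vs)"
  by (simp add: adj_mat_def)

lemma adj_mat_sq:
  assumes "i < length vs" "j < length vs"
  shows "(adj_mat G vs * adj_mat G vs) $$ (i, j) =
    real (card (parcs G `` {vs ! i} \<inter> parcs G `` {vs ! j}))"
proof -
  have "(adj_mat G vs * adj_mat G vs) $$ (i, j) =
      (\<Sum>k<length vs. of_bool ((vs ! i, vs ! k) \<in> parcs G \<and> (vs ! k, vs ! j) \<in> parcs G))"
    using assms by (simp add: adj_mat_def scalar_prod_def atLeast0LessThan of_bool_conj
        del: sum_of_bool_eq sum_of_bool_mult_eq sum_mult_of_bool_eq) (simp only: of_bool_def)
  also have "\<dots> = (\<Sum>w\<in>set vs. of_bool ((vs ! i, w) \<in> parcs G \<and> (w, vs ! j) \<in> parcs G))"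
    by (rule sum_nth_distinct[OF vs])
  also have "\<dots> = real (card {w \<in> set vs. (vs ! i, w) \<in> parcs G \<and> (w, vs ! j) \<in> parcs G})"
    by (simp add: Int_def)
  also have "{w \<in> set vs. (vs ! i, w) \<in> parcs G \<and> (w, vs ! j) \<in> parcs G} =
      parcs G `` {vs ! i} \<inter> parcs G `` {vs ! j}"
    using P sym by (auto dest: symD)
  finally show ?thesis .
qed

lemma trace_adj_mat_2: "mat_trace (adj_mat G vs ^\<^sub>m 2) = real (card (parcs G))"
proof -
  have "mat_trace (adj_mat G vs ^\<^sub>m 2) = (\<Sum>i<length vs. (adj_mat G vs * adj_mat G vs) $$ (i, i))"
    using adj_mat_carrier by (simp add: mat_trace_def numeral_2_eq_2)
  also have "\<dots> = (\<Sum>i<length vs. real (card (parcs G `` {vs ! i})))"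
    by (simp add: adj_mat_sq)
  also have "\<dots> = real (\<Sum>v\<in>set vs. card (parcs G `` {v}))"
    by (simp add: sum_nth_distinct[OF vs, where f = "\<lambda>v. real (card (parcs G `` {v}))"])
  also have "(\<Sum>v\<in>set vs. card (parcs G `` {v})) = card (SIGMA v:set vs. parcs G `` {v})"
    by (rule card_SigmaI[symmetric]) (use P in \<open>auto intro: finite_subset[of _ "set vs"]\<close>)
  also have "(SIGMA v:set vs. parcs G `` {v}) = parcs G" using P by auto
  finally show ?thesis .
qed

lemma trace_adj_mat_4: "mat_trace (adj_mat G vs ^\<^sub>m 4) = real (codeg2 (set vs) (parcs G))"
proof -
  let ?A = "adj_mat G vs" and ?n = "length vs"
  have "?A ^\<^sub>m 4 = (?A * ?A) * (?A * ?A)"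
    using adj_mat_carrier
    by (simp add: numeral_eq_Suc assoc_mult_mat[of _ ?n ?n _ ?n _ ?n] left_mult_one_mat[of _ ?n ?n])
  then have "mat_trace (?A ^\<^sub>m 4) = (\<Sum>i<?n. \<Sum>j<?n. (?A * ?A) $$ (i, j) * (?A * ?A) $$ (j, i))"
    using mat_trace_mult[of "?A * ?A" ?n "?A * ?A"] adj_mat_carrier by auto
  also have "\<dots> = (\<Sum>i<?n. \<Sum>j<?n. (real (card (parcs G `` {vs ! i} \<inter> parcs G `` {vs ! j})))\<^sup>2)"
    by (simp add: adj_mat_sq power2_eq_square Int_commute)
  also have "\<dots> = (\<Sum>u\<in>set vs. \<Sum>v\<in>set vs. (real (card (parcs G `` {u} \<inter> parcs G `` {v})))\<^sup>2)"
    by (subst sum_nth_distinct[OF vs, symmetric], intro sum.cong refl,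
        subst sum_nth_distinct[OF vs, symmetric], rule refl)
  finally show ?thesis by (simp add: codeg2_def)
qed

text \<open>Without triangles adjacent vertices have no common neighbour, so one factor of every
  term is 0.\<close>

lemma trace_adj_mat_3:
  assumes "\<And>u v w. (u, v) \<in> parcs G \<Longrightarrow> (v, w) \<in> parcs G \<Longrightarrow> (w, u) \<notin> parcs G"
  shows "mat_trace (adj_mat G vs ^\<^sub>m 3) = 0"
proof -
  let ?A = "adj_mat G vs" and ?n = "length vs"
  have "?A ^\<^sub>m 3 = (?A * ?A) * ?A"
    using adj_mat_carrier by (simp add: numeral_eq_Suc left_mult_one_mat[of _ ?n ?n])
  then have "mat_trace (?A ^\<^sub>m 3) = (\<Sum>i<?n. \<Sum>j<?n. (?A * ?A) $$ (i, j) * ?A $$ (j, i))"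
    using mat_trace_mult[of "?A * ?A" ?n "?A"] adj_mat_carrier by auto
  also have "\<dots> = 0"
  proof (intro sum.neutral ballI)
    fix i j assume ij: "i \<in> {..<?n}" "j \<in> {..<?n}"
    show "(?A * ?A) $$ (i, j) * ?A $$ (j, i) = 0"
    proof (cases "(vs ! j, vs ! i) \<in> parcs G")
      case True
      then have "parcs G `` {vs ! i} \<inter> parcs G `` {vs ! j} = {}"
        using assms[of "vs ! i" _ "vs ! j"] symD[OF sym] by blast
      then show ?thesis using ij by (simp add: adj_mat_sq)
    qed (use ij in \<open>simp add: adj_mat_def\<close>)
  qed
  finally show ?thesis .
qed

end

text \<open>Vertices on different sides have no common neighbour, and the two sides contribute
  equally by \<open>codeg2_converse\<close>.\<close>

lemma codeg2_bip:
  assumes fin: "finite X" "finite Y" and dis: "X \<inter> Y = {}" and E: "E \<subseteq> X \<times> Y"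
  shows "codeg2 (X \<union> Y) (E \<union> E\<inverse>) = 2 * codeg2 X E"
proof -
  let ?P = "E \<union> E\<inverse>"
  let ?f = "\<lambda>u v. (card (?P `` {u} \<inter> ?P `` {v}))\<^sup>2"
  have nx: "?P `` {x} = E `` {x}" if "x \<in> X" for x using that E dis by auto
  have ny: "?P `` {y} = E\<inverse> `` {y}" if "y \<in> Y" for y using that E dis by auto
  have sub: "E `` {x} \<subseteq> Y" "E\<inverse> `` {x} \<subseteq> X" for x using E by auto
  have cross: "?f x y = 0" "?f y x = 0" if "x \<in> X" "y \<in> Y" for x y
  proof -
    have "E `` {x} \<inter> E\<inverse> `` {y} = {}" using sub[of x] sub[of y] dis by blast
    then show "?f x y = 0" "?f y x = 0" using nx[OF that(1)] ny[OF that(2)] by (simp_all add: Int_commute)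
  qed
  have "codeg2 (X \<union> Y) ?P = (\<Sum>u\<in>X. (\<Sum>v\<in>X. ?f u v) + (\<Sum>v\<in>Y. ?f u v)) +
      (\<Sum>u\<in>Y. (\<Sum>v\<in>X. ?f u v) + (\<Sum>v\<in>Y. ?f u v))"
    unfolding codeg2_def using fin dis by (simp add: sum.union_disjoint)
  also have "\<dots> = (\<Sum>u\<in>X. \<Sum>v\<in>X. ?f u v) + (\<Sum>u\<in>Y. \<Sum>v\<in>Y. ?f u v)"
    using cross by simp
  also have "\<dots> = codeg2 X E + codeg2 Y (E\<inverse>)"
    unfolding codeg2_def using nx ny by simp
  finally show ?thesis using codeg2_converse[OF fin E] by simp
qed

lemma card_union_converse:
  assumes "finite X" "finite Y" "X \<inter> Y = {}" "E \<subseteq> X \<times> Y"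
  shows "card (E \<union> E\<inverse>) = 2 * card E"
proof -
  have "E \<inter> E\<inverse> = {}" using assms by auto
  moreover have "finite E" using assms finite_subset by blast
  ultimately show ?thesis by (simp add: card_Un_disjoint card_inverse)
qed

lemma acoeff4_bip:
  assumes fin: "finite X" "finite Y" and dis: "X \<inter> Y = {}" and E: "E \<subseteq> X \<times> Y"
    and n: "4 \<le> card (X \<union> Y)"
  shows "2 * acoeff 4 (bip X Y E) = real (card E) ^ 2 - real (codeg2 X E)"
proof -
  let ?G = "bip X Y E"
  define vs where "vs = (SOME vs. distinct vs \<and> set vs = pverts ?G)"
  have "\<exists>vs. distinct vs \<and> set vs = pverts ?G"
    using finite_distinct_list[of "pverts ?G"] fin by (auto simp: bip_def)
  then have "distinct vs \<and> set vs = pverts ?G" unfolding vs_def by (rule someI_ex)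
  then have vs: "distinct vs" "set vs = X \<union> Y" by (auto simp: bip_def)
  have P: "parcs ?G \<subseteq> set vs \<times> set vs" using E vs by (auto simp: bip_def)
  have sym: "sym (parcs ?G)" by (auto simp: bip_def sym_def)
  let ?A = "adj_mat ?G vs"
  have len: "length vs = card (X \<union> Y)" using vs distinct_card by metis
  have A: "?A \<in> carrier_mat (card (X \<union> Y)) (card (X \<union> Y))"
    using adj_mat_carrier[OF vs(1) P sym] len by simp
  have "mat_trace ?A = 0"
    using E dis by (auto simp: mat_trace_def adj_mat_def bip_def intro!: sum.neutral)
  moreover have "mat_trace (?A ^\<^sub>m 3) = 0"
    by (rule trace_adj_mat_3[OF vs(1) P sym]) (use E dis in \<open>auto simp: bip_def\<close>)
  ultimately have "8 * coeff (char_poly ?A) (card (X \<union> Y) - 4) =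
      mat_trace (?A ^\<^sub>m 2) ^ 2 - 2 * mat_trace (?A ^\<^sub>m 4)"
    by (rule coeff4_char_poly[OF A n])
  also have "mat_trace (?A ^\<^sub>m 2) = 2 * real (card E)"
    unfolding trace_adj_mat_2[OF vs(1) P sym]
    using card_union_converse[OF fin dis E] by (simp add: bip_def)
  also have "mat_trace (?A ^\<^sub>m 4) = 2 * real (codeg2 X E)"
    unfolding trace_adj_mat_4[OF vs(1) P sym] vs(2)
    using codeg2_bip[OF fin dis E] by (simp add: bip_def)
  finally show ?thesis
    unfolding acoeff_def graph_char_poly_def vs_def[symmetric]
    by (simp add: bip_def power2_eq_square)
qed

text \<open>Connectivity as the absence of a nontrivial union of components. In this form it can be
  checked after an exchange of edges without rerouting paths.\<close>

definition bip_connected :: "'a set \<Rightarrow> 'b set \<Rightarrow> ('a \<times> 'b) set \<Rightarrow> bool" where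
  "bip_connected X Y E \<longleftrightarrow> (X \<noteq> {} \<or> Y \<noteq> {}) \<and>
     (\<forall>A B. A \<subseteq> X \<longrightarrow> B \<subseteq> Y \<longrightarrow> (\<forall>(x, y) \<in> E. x \<in> A \<longleftrightarrow> y \<in> B) \<longrightarrow>
        (A = {} \<and> B = {}) \<or> (A = X \<and> B = Y))"

lemma bip_connectedI:
  assumes "X \<noteq> {} \<or> Y \<noteq> {}"
    and "\<And>A B. \<lbrakk>A \<subseteq> X; B \<subseteq> Y; \<And>x y. (x, y) \<in> E \<Longrightarrow> x \<in> A \<longleftrightarrow> y \<in> B\<rbrakk> \<Longrightarrow>
      (A = {} \<and> B = {}) \<or> (A = X \<and> B = Y)"
  shows "bip_connected X Y E"
  unfolding bip_connected_def
proof (intro conjI allI impI)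
  fix A B assume "A \<subseteq> X" "B \<subseteq> Y" "\<forall>(x, y) \<in> E. x \<in> A \<longleftrightarrow> y \<in> B"
  then show "(A = {} \<and> B = {}) \<or> (A = X \<and> B = Y)" by (intro assms(2)) blast+
qed (rule assms(1))

lemma bip_connectedD:
  assumes "bip_connected X Y E" "A \<subseteq> X" "B \<subseteq> Y" "\<And>x y. (x, y) \<in> E \<Longrightarrow> x \<in> A \<longleftrightarrow> y \<in> B"
  shows "(A = {} \<and> B = {}) \<or> (A = X \<and> B = Y)"
proof -
  have "\<forall>(x, y) \<in> E. x \<in> A \<longleftrightarrow> y \<in> B" using assms(4) by blast
  then show ?thesis using assms(1-3) unfolding bip_connected_def by metis
qed

lemma bip_connected_converseI:
  assumes "bip_connected X Y E"
  shows "bip_connected Y X (E\<inverse>)"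
proof (rule bip_connectedI)
  show "Y \<noteq> {} \<or> X \<noteq> {}" using assms by (auto simp: bip_connected_def)
  fix A B assume "A \<subseteq> Y" "B \<subseteq> X" "\<And>y x. (y, x) \<in> E\<inverse> \<Longrightarrow> y \<in> A \<longleftrightarrow> x \<in> B"
  then show "(A = {} \<and> B = {}) \<or> (A = Y \<and> B = X)"
    using bip_connectedD[OF assms, of B A] by auto
qed

lemma connected_bip:
  assumes dis: "X \<inter> Y = {}" and E: "E \<subseteq> X \<times> Y"
  shows "connected (with_proj (bip X Y E)) \<longleftrightarrow> bip_connected X Y E"
proof -
  let ?P = "E \<union> E\<inverse>" and ?V = "X \<union> Y"
  have "symcl ?P = ?P" by (auto simp: symcl_def image_iff)
  then have conv: "connected (with_proj (bip X Y E)) \<longleftrightarrow>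
      ?V \<noteq> {} \<and> (\<forall>u\<in>?V. \<forall>v\<in>?V. (u, v) \<in> rtrancl_on ?V ?P)"
    unfolding connected_conv by (simp add: bip_def)
  show ?thesis
  proof
    assume c: "connected (with_proj (bip X Y E))"
    show "bip_connected X Y E"
    proof (rule bip_connectedI)
      show "X \<noteq> {} \<or> Y \<noteq> {}" using c conv by auto
      fix A B assume AB: "A \<subseteq> X" "B \<subseteq> Y" "\<And>x y. (x, y) \<in> E \<Longrightarrow> x \<in> A \<longleftrightarrow> y \<in> B"
      have "(A = X \<and> B = Y)" if u: "u \<in> A \<union> B" for u
      proof -
        have "v \<in> A \<union> B" if "v \<in> ?V" for v
        proof -
          have "(u, v) \<in> rtrancl_on ?V ?P" using c conv that u AB by blast
          then show ?thesis
          proof (induction rule: rtrancl_on_induct)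
            case base show ?case by (rule u)
          next
            case (step y z)
            then show ?case using AB E dis by blast
          qed
        qed
        then show ?thesis using AB dis by blast
      qed
      then show "(A = {} \<and> B = {}) \<or> (A = X \<and> B = Y)" by blast
    qed
  next
    assume c: "bip_connected X Y E"
    have "(u, v) \<in> rtrancl_on ?V ?P" if u: "u \<in> ?V" and v: "v \<in> ?V" for u v
    proof -
      let ?R = "\<lambda>v. (u, v) \<in> rtrancl_on ?V ?P"
      have "?R x \<longleftrightarrow> ?R y" if "(x, y) \<in> E" for x y
        using that E by (auto intro: rtrancl_on_into_rtrancl_on)
      \<comment> \<open>The vertices reachable from \<open>u\<close> are closed under
        \<open>E\<close> in both directions.\<close>
      then have "({x \<in> X. ?R x} = {} \<and> {y \<in> Y. ?R y} = {}) \<or> ({x \<in> X. ?R x} = X \<and> {y \<in> Y. ?R y} = Y)"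
        using E by (intro bip_connectedD[OF c]) auto
      moreover have "u \<in> {x \<in> X. ?R x} \<or> u \<in> {y \<in> Y. ?R y}" using u by auto
      ultimately have "{x \<in> X. ?R x} = X \<and> {y \<in> Y. ?R y} = Y" by blast
      then show ?thesis using v by blast
    qed
    then show "connected (with_proj (bip X Y E))"
      using c unfolding conv bip_connected_def by blast
  qed
qed

section \<open>Translation between graphs and relations\<close>

lemma card_edge_set_bip:
  assumes "X \<inter> Y = {}" "E \<subseteq> X \<times> Y"
  shows "card (edge_set (bip X Y E)) = card E"
proof -
  have "edge_set (bip X Y E) = (\<lambda>(x, y). {x, y}) ` E"
  proof
    show "edge_set (bip X Y E) \<subseteq> (\<lambda>(x, y). {x, y}) ` E"
    proof
      fix e assume "e \<in> edge_set (bip X Y E)"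
      then obtain u v where "e = {u, v}" "(u, v) \<in> E \<or> (v, u) \<in> E"
        by (auto simp: edge_set_def bip_def)
      then have "e = (\<lambda>(x, y). {x, y}) (u, v) \<and> (u, v) \<in> E \<or> e = (\<lambda>(x, y). {x, y}) (v, u) \<and> (v, u) \<in> E"
        by auto
      then show "e \<in> (\<lambda>(x, y). {x, y}) ` E" by blast
    qed
    show "(\<lambda>(x, y). {x, y}) ` E \<subseteq> edge_set (bip X Y E)"
      unfolding edge_set_def bip_def by fastforce
  qed
  moreover have "inj_on (\<lambda>(x, y). {x, y}) E"
    using assms by (force simp: inj_on_def doubleton_eq_iff dest: subsetD[OF assms(2)])
  ultimately show ?thesis by (simp add: card_image)
qed

lemma bipartition_bip:
  assumes "X \<inter> Y = {}" "E \<subseteq> X \<times> Y"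
  shows "bipartition (bip X Y E) X Y"
  using assms by (auto simp: bipartition_def bip_def)

lemma pair_graph_bip:
  assumes fin: "finite X" "finite Y" and dis: "X \<inter> Y = {}" and E: "E \<subseteq> X \<times> Y"
  shows "pair_graph (bip X Y E)"
proof
  have "finite E" using fin E finite_subset by blast
  then show "finite (parcs (bip X Y E))" by (simp add: bip_def)
  show "finite (pverts (bip X Y E))" using fin by (simp add: bip_def)
  show "symmetric (with_proj (bip X Y E))" by (auto simp: bip_def symmetric_def sym_def)
qed (use dis E in \<open>auto simp: bip_def\<close>)

lemma bip_in_conn_bipartite_graphs:
  assumes fin: "finite X" "finite Y" and dis: "X \<inter> Y = {}" and E: "E \<subseteq> X \<times> Y"
  shows "bip X Y E \<in> conn_bipartite_graphs n m \<longleftrightarrow>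
    bip_connected X Y E \<and> card X + card Y = n \<and> card E = m"
proof -
  have "card (pverts (bip X Y E)) = card X + card Y"
    using fin dis by (simp add: bip_def card_Un_disjoint)
  then show ?thesis
    using pair_graph_bip[OF assms] bipartition_bip[OF dis E]
      card_edge_set_bip[OF dis E] connected_bip[OF dis E]
    by (auto simp: conn_bipartite_graphs_def bipartite_def)
qed

lemma graph_eq_bip:
  assumes G: "pair_graph G" and b: "bipartition G X Y"
  shows "G = bip X Y (parcs G \<inter> X \<times> Y)" "finite X" "finite Y" "X \<inter> Y = {}"
proof -
  interpret pair_graph G by (rule G)
  have "finite (X \<union> Y)" using b pair_finite_verts by (simp add: bipartition_def)
  then show "finite X" "finite Y" by auto
  show "X \<inter> Y = {}" using b by (simp add: bipartition_def)
  have "(v, u) \<in> parcs G" if "(u, v) \<in> parcs G" for u v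
    using that pair_sym_arcs by (auto simp: symmetric_def dest: symD)
  then have "parcs G = (parcs G \<inter> X \<times> Y) \<union> (parcs G \<inter> X \<times> Y)\<inverse>"
    using b by (fastforce simp: bipartition_def)
  then show "G = bip X Y (parcs G \<inter> X \<times> Y)"
    using b by (simp add: bip_def bipartition_def)
qed

text \<open>
  Competitors are restricted to the vertex set of the given graph, which is why nothing has to be
  assumed about the size of the vertex type.
\<close>

locale optimal_bip =
  fixes X Y :: "'a set" and E :: "('a \<times> 'a) set"
  assumes finX: "finite X" and finY: "finite Y" and dis: "X \<inter> Y = {}" and E: "E \<subseteq> X \<times> Y"
    and conn: "bip_connected X Y E"
    and opt: "\<And>X' Y' E'. \<lbrakk>X' \<union> Y' = X \<union> Y; X' \<inter> Y' = {}; E' \<subseteq> X' \<times> Y'; bip_connected X' Y' E';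
      card E' = card E\<rbrakk> \<Longrightarrow> codeg2 X' E' \<le> codeg2 X E"

lemma optimal_bipI:
  assumes o: "bipartite_optimal n m G" and n: "4 \<le> n" and b: "bipartition G X Y"
  shows "optimal_bip X Y (parcs G \<inter> X \<times> Y)"
    and "card X + card Y = n" and "card (parcs G \<inter> X \<times> Y) = m"
proof -
  let ?E = "parcs G \<inter> X \<times> Y"
  have G: "G \<in> conn_bipartite_graphs n m" using o by (simp add: bipartite_optimal_def)
  then have pg: "pair_graph G" by (simp add: conn_bipartite_graphs_def)
  note D = graph_eq_bip[OF pg b]
  have mem: "bip_connected X Y ?E \<and> card X + card Y = n \<and> card ?E = m"
    using bip_in_conn_bipartite_graphs[OF D(2-4), of ?E n m] G D(1) by auto
  then show "card X + card Y = n" "card ?E = m" by auto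
  have cV: "card (X \<union> Y) = n" using mem D by (simp add: card_Un_disjoint)
  show "optimal_bip X Y ?E"
  proof
    fix X' Y' :: "'a set" and E'
    assume a: "X' \<union> Y' = X \<union> Y" "X' \<inter> Y' = {}" "E' \<subseteq> X' \<times> Y'" "bip_connected X' Y' E'"
      "card E' = card ?E"
    have f: "finite X'" "finite Y'" using a(1) D by (metis finite_Un)+
    have "card X' + card Y' = n" using cV a f by (metis card_Un_disjoint)
    then have "bip X' Y' E' \<in> conn_bipartite_graphs n m"
      using bip_in_conn_bipartite_graphs[OF f a(2,3), of n m] a mem by simp
    then have "acoeff 4 (bip X Y ?E) \<le> acoeff 4 (bip X' Y' E')"
      using o D(1) by (simp add: bipartite_optimal_def)
    then have "real (codeg2 X' E') \<le> real (codeg2 X ?E)"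
      using acoeff4_bip[OF f a(2,3)] acoeff4_bip[OF D(2-4), of ?E] a(1,5) cV n by simp
    then show "codeg2 X' E' \<le> codeg2 X ?E" by simp
  qed (use D mem in auto)
qed

text \<open>The objective does not depend on the side on which it is computed, so every fact about
  the rows \<open>X\<close> also holds for the columns \<open>Y\<close>.\<close>

lemma (in optimal_bip) converse: "optimal_bip Y X (E\<inverse>)"
proof
  fix X' Y' :: "'a set" and E'
  assume a: "X' \<union> Y' = Y \<union> X" "X' \<inter> Y' = {}" "E' \<subseteq> X' \<times> Y'" "bip_connected X' Y' E'"
    "card E' = card (E\<inverse>)"
  then have "codeg2 X' E' \<le> codeg2 X E" by (intro opt) (auto simp: card_inverse)
  then show "codeg2 X' E' \<le> codeg2 Y (E\<inverse>)" using codeg2_converse[OF finX finY E] by simp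
qed (use finX finY dis E conn in \<open>auto simp: bip_connected_converseI\<close>)

section \<open>Nestedness of optimal graphs\<close>

text \<open>With \<open>a = i + k\<close> and \<open>b = i + l\<close> the gain is
  \<open>2 * k * l\<close>. Later \<open>i\<close> and \<open>t\<close> are the sizes of an
  intersection and a union.\<close>

lemma sum_squares_spread:
  fixes a b i t :: nat
  assumes "i + t = a + b" "i \<le> a" "i \<le> b"
  shows "a\<^sup>2 + b\<^sup>2 \<le> i\<^sup>2 + t\<^sup>2" and "i < a \<Longrightarrow> i < b \<Longrightarrow> a\<^sup>2 + b\<^sup>2 < i\<^sup>2 + t\<^sup>2"
proof -
  obtain k l where kl: "a = i + k" "b = i + l" using assms by (metis le_Suc_ex)
  then have "t = i + k + l" using assms by simp
  then have "i\<^sup>2 + t\<^sup>2 = a\<^sup>2 + b\<^sup>2 + 2 * (k * l)"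
    unfolding kl by (simp add: power2_eq_square algebra_simps)
  then show "a\<^sup>2 + b\<^sup>2 \<le> i\<^sup>2 + t\<^sup>2" "i < a \<Longrightarrow> i < b \<Longrightarrow> a\<^sup>2 + b\<^sup>2 < i\<^sup>2 + t\<^sup>2"
    using kl by auto
qed

text \<open>Isolates the terms that change when only the neighbourhoods of \<open>u\<close> and
  \<open>v\<close> are altered.\<close>

lemma sum_sum_two_points:
  fixes g :: "'a \<Rightarrow> 'a \<Rightarrow> nat"
  assumes "finite X" "u \<in> X" "v \<in> X" "u \<noteq> v" and sym: "\<And>x y. g x y = g y x"
  shows "(\<Sum>x\<in>X. \<Sum>y\<in>X. g x y) = (\<Sum>x\<in>X - {u, v}. \<Sum>y\<in>X - {u, v}. g x y)
    + 2 * (\<Sum>x\<in>X - {u, v}. g x u + g x v) + (g u u + g v v) + 2 * g u v"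
proof -
  let ?R = "X - {u, v}"
  have split: "sum f X = sum f ?R + f u + f v" for f :: "'a \<Rightarrow> nat"
  proof -
    have "X = insert u (insert v ?R)" using assms by auto
    moreover have "sum f (insert u (insert v ?R)) = sum f ?R + f u + f v" using assms by simp
    ultimately show ?thesis by simp
  qed
  have "(\<Sum>y\<in>?R. g u y) = (\<Sum>x\<in>?R. g x u)" "(\<Sum>y\<in>?R. g v y) = (\<Sum>x\<in>?R. g x v)"
    by (intro sum.cong refl sym)+
  moreover have "g v u = g u v" by (rule sym)
  ultimately show ?thesis
    unfolding split sum.distrib by simp
qed

context optimal_bip
begin

text \<open>
  Replacing the neighbourhoods of \<open>u\<close> and \<open>v\<close> by their intersection and their union keeps the
  graph connected, because both stay adjacent to \<open>w\<close>, and raises \<open>codeg2\<close> unless they were nested.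
\<close>

lemma neighbours_comparable:
  assumes u: "u \<in> X" and v: "v \<in> X" and common: "w \<in> E `` {u}" "w \<in> E `` {v}"
  shows "E `` {u} \<subseteq> E `` {v} \<or> E `` {v} \<subseteq> E `` {u}"
proof (rule ccontr)
  assume inc: "\<not> ?thesis"
  let ?I = "E `` {u} \<inter> E `` {v}" and ?U = "E `` {u} \<union> E `` {v}" and ?D = "E `` {u} - E `` {v}"
  let ?E = "(E - {u} \<times> ?D) \<union> {v} \<times> ?D"
  have uv: "u \<noteq> v" using inc by auto
  have finE: "finite E" using E finX finY finite_subset by blast
  have finN: "finite (E `` S)" for S using finE by (rule finite_Image)
  have nb: "?E `` {u} = ?I" "?E `` {v} = ?U" "\<And>x. x \<noteq> u \<Longrightarrow> x \<noteq> v \<Longrightarrow> ?E `` {x} = E `` {x}"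
    using uv by auto
  have "?E \<subseteq> X \<times> Y" using E v by auto
  moreover have "bip_connected X Y ?E"
  proof (rule bip_connectedI)
    show "X \<noteq> {} \<or> Y \<noteq> {}" using u by auto
    fix A B assume AB: "A \<subseteq> X" "B \<subseteq> Y" "\<And>x y. (x, y) \<in> ?E \<Longrightarrow> x \<in> A \<longleftrightarrow> y \<in> B"
    have "u \<in> A \<longleftrightarrow> v \<in> A" using AB(3)[of u w] AB(3)[of v w] common by auto
    then have "x \<in> A \<longleftrightarrow> y \<in> B" if "(x, y) \<in> E" for x y
      using AB(3)[of x y] AB(3)[of v y] that by (cases "x = u \<and> y \<in> ?D") auto
    then show "(A = {} \<and> B = {}) \<or> (A = X \<and> B = Y)"
      by (intro bip_connectedD[OF conn AB(1,2)])
  qed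
  moreover have "card ?E = card E"
  proof -
    have "card ?E = card (E - {u} \<times> ?D) + card ({v} \<times> ?D)"
      using finE finN by (intro card_Un_disjoint) auto
    also have "card (E - {u} \<times> ?D) = card E - card ({u} \<times> ?D)"
      using finN by (intro card_Diff_subset) auto
    also have "card ({u} \<times> ?D) \<le> card E" using finE by (intro card_mono) auto
    moreover have "card ({v} \<times> ?D) = card ({u} \<times> ?D)" by (simp only: card_cartesian_product_singleton)
    ultimately show ?thesis using \<open>card ({u} \<times> ?D) \<le> card E\<close> by simp
  qed
  ultimately have "codeg2 X ?E \<le> codeg2 X E" using dis by (intro opt) auto
  moreover have "codeg2 X E < codeg2 X ?E"
  proof -
    define g where "g x y = (card (E `` {x} \<inter> E `` {y}))\<^sup>2" for x y
    define h where "h x y = (card (?E `` {x} \<inter> ?E `` {y}))\<^sup>2" for x y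
    have sym: "g x y = g y x" "h x y = h y x" for x y by (simp_all add: g_def h_def Int_commute)
    have c: "codeg2 X E = (\<Sum>x\<in>X. \<Sum>y\<in>X. g x y)" "codeg2 X ?E = (\<Sum>x\<in>X. \<Sum>y\<in>X. h x y)"
      by (simp_all add: codeg2_def g_def h_def)
    have R: "(\<Sum>x\<in>X - {u, v}. \<Sum>y\<in>X - {u, v}. g x y) = (\<Sum>x\<in>X - {u, v}. \<Sum>y\<in>X - {u, v}. h x y)"
      by (intro sum.cong refl) (simp add: g_def h_def nb(3))
    \<comment> \<open>\<open>?I\<close> is contained in \<open>?U\<close>, so the codegree of
      \<open>u\<close> and \<open>v\<close> is still \<open>card ?I\<close>.\<close>
    have uv_eq: "g u v = h u v"
      unfolding g_def h_def nb(1,2) by (rule arg_cong[of _ _ "\<lambda>S. (card S)\<^sup>2"]) auto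
    have "(\<Sum>x\<in>X - {u, v}. g x u + g x v) \<le> (\<Sum>x\<in>X - {u, v}. h x u + h x v)"
    proof (rule sum_mono)
      fix x assume x: "x \<in> X - {u, v}"
      let ?N = "E `` {x}"
      have "card (?N \<inter> ?I) + card (?N \<inter> ?U) = card (?N \<inter> E `` {u}) + card (?N \<inter> E `` {v})"
      proof -
        have "card (?N \<inter> E `` {u}) + card (?N \<inter> E `` {v}) =
          card ((?N \<inter> E `` {u}) \<union> (?N \<inter> E `` {v})) + card ((?N \<inter> E `` {u}) \<inter> (?N \<inter> E `` {v}))"
          using finN by (intro card_Un_Int) auto
        then show ?thesis by (simp add: Int_Un_distrib Int_ac)
      qed
      moreover have "card (?N \<inter> ?I) \<le> card (?N \<inter> E `` {u})" "card (?N \<inter> ?I) \<le> card (?N \<inter> E `` {v})"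
        using finN by (auto intro!: card_mono)
      ultimately show "g x u + g x v \<le> h x u + h x v"
        using sum_squares_spread(1) nb x unfolding g_def h_def by simp
    qed
    moreover have "g u u + g v v < h u u + h v v"
    proof -
      have "card ?I + card ?U = card (E `` {u}) + card (E `` {v})"
        using card_Un_Int[of "E `` {u}" "E `` {v}"] finN by simp
      moreover have "card ?I < card (E `` {u})" "card ?I < card (E `` {v})"
        using finN inc by (auto intro!: psubset_card_mono)
      ultimately show ?thesis
        using sum_squares_spread(2)[of "card ?I" "card ?U"] nb(1,2) unfolding g_def h_def by simp
    qed
    ultimately show ?thesis
      unfolding c sum_sum_two_points[of X u v g, OF finX u v uv sym(1)]
        sum_sum_two_points[of X u v h, OF finX u v uv sym(2)]
      using R uv_eq by linarith
  qed
  ultimately show False by simp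
qed

text \<open>
  The vertices sharing a neighbour with a vertex \<open>v\<close> of maximal degree have their neighbourhoods
  inside that of \<open>v\<close>, so together with these neighbours they form a connected component.
\<close>

lemma ex_full_vertex:
  assumes "E \<noteq> {}"
  shows "\<exists>x\<in>X. E `` {x} = Y"
proof -
  have finN: "finite (E `` {x})" for x
    by (rule finite_subset[OF _ finY]) (use E in auto)
  have X: "X \<noteq> {}" using assms E by auto
  let ?M = "(\<lambda>x. card (E `` {x})) ` X"
  have "Max ?M \<in> ?M" using X finX by (intro Max_in) auto
  then obtain v where v: "v \<in> X" and Mv: "card (E `` {v}) = Max ?M" by (auto dest: sym)
  have vmax: "card (E `` {x}) \<le> card (E `` {v})" if "x \<in> X" for x
    unfolding Mv using that finX by (intro Max_ge) auto
  obtain x y where xy: "(x, y) \<in> E" using assms by auto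
  then have "card (E `` {x}) > 0" using finN by (auto simp: card_gt_0_iff)
  then have ne: "E `` {v} \<noteq> {}" using vmax[of x] xy subsetD[OF E xy] by auto
  define A where "A = {x \<in> X. E `` {x} \<inter> E `` {v} \<noteq> {}}"
  have "(A = {} \<and> E `` {v} = {}) \<or> (A = X \<and> E `` {v} = Y)"
  proof (rule bip_connectedD[OF conn])
    show "A \<subseteq> X" "E `` {v} \<subseteq> Y" using E by (auto simp: A_def)
    fix x y assume xy: "(x, y) \<in> E"
    then have x: "x \<in> X" using E by auto
    have "y \<in> E `` {v}" if xA: "x \<in> A"
    proof -
      obtain w where "w \<in> E `` {x}" "w \<in> E `` {v}" using xA by (auto simp: A_def)
      then consider "E `` {x} \<subseteq> E `` {v}" | "E `` {v} \<subseteq> E `` {x}"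
        using neighbours_comparable[OF x v] by metis
      then show ?thesis
      proof cases
        case 1
        then show ?thesis using xy by auto
      next
        case 2
        then have "E `` {v} = E `` {x}" using card_seteq[OF finN 2 vmax[OF x]] by simp
        then show ?thesis using xy by auto
      qed
    qed
    moreover have "x \<in> A" if "y \<in> E `` {v}" using that xy x by (auto simp: A_def)
    ultimately show "x \<in> A \<longleftrightarrow> y \<in> E `` {v}" by metis
  qed
  then show ?thesis using ne v by auto
qed

end

text \<open>A full vertex of \<open>Y\<close>, found by applying \<open>ex_full_vertex\<close> to
  the converse, is a common neighbour of any two vertices of \<open>X\<close>.\<close>

lemma (in optimal_bip) nested:
  assumes "E \<noteq> {}" "u \<in> X" "v \<in> X"
  shows "E `` {u} \<subseteq> E `` {v} \<or> E `` {v} \<subseteq> E `` {u}"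
proof -
  interpret c: optimal_bip Y X "E\<inverse>" by (rule converse)
  obtain y where "y \<in> Y" "E\<inverse> `` {y} = X" using c.ex_full_vertex assms by auto
  then have "y \<in> E `` {u}" "y \<in> E `` {v}" using assms by auto
  then show ?thesis using neighbours_comparable assms by auto
qed

section \<open>Column heights\<close>

text \<open>
  A nested bipartite graph is a Young diagram: the columns are the vertices of \<open>Y\<close>, their heights
  the degrees, and \<open>minsq\<close> of the multiset of heights is \<open>codeg2\<close>.
\<close>

definition minsq :: "nat multiset \<Rightarrow> nat" where
  "minsq C = (\<Sum>a\<in>#C. \<Sum>b\<in>#C. (min a b)\<^sup>2)"

lemma minsq_add_mset: "minsq (add_mset x C) = minsq C + x\<^sup>2 + 2 * (\<Sum>b\<in>#C. (min x b)\<^sup>2)"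
  by (simp add: minsq_def sum_mset.distrib min.commute[of _ x] mult_2 del: sum_mset_distrib_left)

lemma minsq_add_min:
  assumes "\<And>b. b \<in># C \<Longrightarrow> s \<le> b"
  shows "minsq (add_mset s C) = minsq C + s\<^sup>2 * (2 * size C + 1)"
proof -
  have "(\<Sum>b\<in>#C. (min s b)\<^sup>2) = (\<Sum>b\<in>#C. s\<^sup>2)"
    using assms by (intro arg_cong[of _ _ sum_mset] image_mset_cong) (simp add: min_absorb1)
  then show ?thesis unfolding minsq_add_mset by (simp add: algebra_simps)
qed

lemma minsq_add_max:
  assumes "\<And>b. b \<in># C \<Longrightarrow> b \<le> p"
  shows "minsq (add_mset p C) = minsq C + p\<^sup>2 + 2 * (\<Sum>b\<in>#C. b\<^sup>2)"
proof -
  have "(\<Sum>b\<in>#C. (min p b)\<^sup>2) = (\<Sum>b\<in>#C. b\<^sup>2)"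
    using assms by (intro arg_cong[of _ _ sum_mset] image_mset_cong) (simp add: min_absorb2)
  then show ?thesis unfolding minsq_add_mset by simp
qed

lemma minsq_replicate_max:
  assumes "\<And>b. b \<in># C \<Longrightarrow> b \<le> p"
  shows "minsq (replicate_mset k p + C) = minsq C + k\<^sup>2 * p\<^sup>2 + 2 * k * (\<Sum>b\<in>#C. b\<^sup>2)"
proof (induction k)
  case (Suc k)
  define S where "S = (\<Sum>b\<in>#C. b\<^sup>2)"
  have S: "(\<Sum>b\<in># replicate_mset k p + C. b\<^sup>2) = k * p\<^sup>2 + S" by (simp add: S_def)
  have "minsq (replicate_mset (Suc k) p + C) = minsq (replicate_mset k p + C) + p\<^sup>2
      + 2 * (\<Sum>b\<in># replicate_mset k p + C. b\<^sup>2)"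
    unfolding replicate_mset_Suc union_mset_add_mset_left
    by (rule minsq_add_max) (use assms in \<open>auto split: if_splits\<close>)
  then show ?case unfolding Suc.IH S S_def[symmetric] by (simp add: algebra_simps power2_eq_square)
qed simp

text \<open>The square of \<open>min a b\<close> is at most \<open>a * b\<close>. The bound is
  crude, but it reduces the interplay of the low columns to the sum of their heights.\<close>

lemma minsq_le: "minsq C \<le> (\<Sum>\<^sub># C)\<^sup>2"
proof -
  have "minsq C \<le> (\<Sum>a\<in>#C. \<Sum>b\<in>#C. a * b)"
    unfolding minsq_def power2_eq_square
    by (intro sum_mset_mono mult_mono) auto
  also have "\<dots> = (\<Sum>\<^sub># C)\<^sup>2"
    using sum_mset_product[of "\<lambda>a. a" C "\<lambda>b. b" C] by (simp add: power2_eq_square)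
  finally show ?thesis .
qed

definition degs :: "'b set \<Rightarrow> ('a \<times> 'b) set \<Rightarrow> nat multiset" where
  "degs Y E = image_mset (\<lambda>y. card (E\<inverse> `` {y})) (mset_set Y)"

lemma minsq_degs_nested:
  assumes "finite Y" "finite E" and nested: "\<And>u v. u \<in> Y \<Longrightarrow> v \<in> Y \<Longrightarrow> E\<inverse> `` {u} \<subseteq> E\<inverse> `` {v} \<or> E\<inverse> `` {v} \<subseteq> E\<inverse> `` {u}"
  shows "minsq (degs Y E) = codeg2 Y (E\<inverse>)"
proof -
  have "card (E\<inverse> `` {u} \<inter> E\<inverse> `` {v}) = min (card (E\<inverse> `` {u})) (card (E\<inverse> `` {v}))"
    if "u \<in> Y" "v \<in> Y" for u v
  proof -
    have fin: "finite (E\<inverse> `` {w})" for w using assms by (intro finite_Image) simp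
    show ?thesis using nested[OF that]
    proof
      assume "E\<inverse> `` {u} \<subseteq> E\<inverse> `` {v}"
      then show ?thesis using card_mono[OF fin, of _ v] by (simp add: Int_absorb2 min_absorb1)
    next
      assume "E\<inverse> `` {v} \<subseteq> E\<inverse> `` {u}"
      then show ?thesis using card_mono[OF fin, of _ u] by (simp add: Int_absorb1 min_absorb2)
    qed
  qed
  then show ?thesis
    by (simp add: minsq_def degs_def codeg2_def sum_unfold_sum_mset[symmetric] image_mset.compositionality comp_def)
qed

lemma sum_degs:
  assumes "finite X" "finite Y" "E \<subseteq> X \<times> Y"
  shows "\<Sum>\<^sub># (degs Y E) = card E"
proof -
  have "\<Sum>\<^sub># (degs Y E) = (\<Sum>y\<in>Y. card (E\<inverse> `` {y}))"
    by (simp add: degs_def sum_unfold_sum_mset)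
  also have "\<dots> = card (SIGMA y:Y. E\<inverse> `` {y})"
    by (rule card_SigmaI[symmetric]) (use assms in \<open>auto intro: finite_subset[of _ X]\<close>)
  also have "(SIGMA y:Y. E\<inverse> `` {y}) = E\<inverse>" using assms by auto
  finally show ?thesis by (simp add: card_inverse)
qed

text \<open>The rows are numbered by \<open>f\<close>, and the column \<open>y\<close> consists of
  the first \<open>h y\<close> rows. Row 0 is full because no height is 0, and a column of height
  \<open>p\<close> is full; together they connect the graph. Any \<open>p\<close> vertices may serve
  as \<open>X\<close>, so a competitor may have sides of other sizes than the given graph.\<close>

lemma realize_degs:
  fixes V :: "'a set"
  assumes "finite V" and C: "card V = p + size C" "p \<in># C" "\<And>c. c \<in># C \<Longrightarrow> 1 \<le> c \<and> c \<le> p"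
  shows "\<exists>X Y E. X \<union> Y = V \<and> X \<inter> Y = {} \<and> E \<subseteq> X \<times> Y \<and> bip_connected X Y E \<and>
    card E = \<Sum>\<^sub># C \<and> codeg2 X E = minsq C"
proof -
  obtain X where X: "X \<subseteq> V" "card X = p" by (metis C(1) le_add1 obtain_subset_with_card_n)
  define Y where "Y = V - X"
  have fin: "finite X" "finite Y" using assms(1) X finite_subset by (auto simp: Y_def)
  have cY: "card Y = size C" using X C(1) fin by (simp add: Y_def card_Diff_subset)
  obtain f where f: "bij_betw f {0..<p} X" using ex_bij_betw_nat_finite[OF fin(1)] X by auto
  obtain ys where ys: "distinct ys" "set ys = Y" using finite_distinct_list[OF fin(2)] by auto
  obtain cs where cs: "mset cs = C" using ex_mset by auto
  have len: "length ys = length cs" using ys cY cs distinct_card[of ys] size_mset[of cs] by auto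
  define h where "h y = the (map_of (zip ys cs) y)" for y
  have hnth: "h (ys ! i) = cs ! i" if "i < length ys" for i
    using that len ys(1) by (simp add: h_def map_of_zip_nth)
  have hC: "image_mset h (mset_set Y) = C"
  proof -
    have "image_mset h (mset_set Y) = image_mset h (mset ys)" using mset_set_set[OF ys(1)] ys(2) by simp
    also have "\<dots> = mset (map h ys)" by simp
    also have "map h ys = cs" using hnth len by (intro nth_equalityI) auto
    finally show ?thesis using cs by simp
  qed
  have hle: "1 \<le> h y" "h y \<le> p" if "y \<in> Y" for y
    using that C(3)[of "h y"] fin unfolding hC[symmetric] by auto
  define E where "E = {(f i, y) |i y. y \<in> Y \<and> i < h y}"
  have E: "E \<subseteq> X \<times> Y"
  proof
    fix e assume "e \<in> E"
    then obtain i y where e: "e = (f i, y)" "y \<in> Y" "i < h y" by (auto simp: E_def)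
    then have "i \<in> {0..<p}" using hle(2)[of y] by simp
    then show "e \<in> X \<times> Y" using bij_betwE[OF f] e by simp
  qed
  have nb: "E\<inverse> `` {y} = f ` {..<h y}" if "y \<in> Y" for y using that by (auto simp: E_def)
  have inj: "inj_on f {..<h y}" if "y \<in> Y" for y
    by (rule inj_on_subset[of f "{0..<p}"]) (use f hle(2)[OF that] in \<open>auto simp: bij_betw_def\<close>)
  have "degs Y E = image_mset h (mset_set Y)"
    unfolding degs_def using fin nb inj by (intro image_mset_cong) (simp add: card_image)
  then have degs: "degs Y E = C" using hC by simp
  have finE: "finite E" using E fin finite_subset by blast
  have "codeg2 Y (E\<inverse>) = minsq C"
  proof -
    have "E\<inverse> `` {u} \<subseteq> E\<inverse> `` {v} \<or> E\<inverse> `` {v} \<subseteq> E\<inverse> `` {u}" if "u \<in> Y" "v \<in> Y" for u v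
      unfolding nb[OF that(1)] nb[OF that(2)] by (cases "h u \<le> h v") auto
    then show ?thesis using minsq_degs_nested[OF fin(2) finE] degs by simp
  qed
  then have "codeg2 X E = minsq C" using codeg2_converse[OF fin E] by simp
  moreover have "card E = \<Sum>\<^sub># C" using sum_degs[OF fin E] degs by simp
  moreover have "bip_connected X Y E"
  proof -
    have "p > 0" using C(2,3) by force
    then have f0: "f 0 \<in> X" using f by (auto simp: bij_betw_def)
    have "p \<in># image_mset h (mset_set Y)" using C(2) hC by simp
    then obtain y0 where y0: "y0 \<in> Y" "h y0 = p" using fin by auto
    have e: "(f 0, y) \<in> E" if "y \<in> Y" for y using hle[OF that] that by (force simp: E_def)
    have e': "(x, y0) \<in> E" if "x \<in> X" for x
    proof -
      have "x \<in> f ` {0..<p}" using that f by (simp add: bij_betw_def)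
      then show ?thesis using y0 by (auto simp: E_def)
    qed
    show ?thesis
    proof (rule bip_connectedI)
      show "X \<noteq> {} \<or> Y \<noteq> {}" using f0 by auto
      fix A B assume AB: "A \<subseteq> X" "B \<subseteq> Y" "\<And>x y. (x, y) \<in> E \<Longrightarrow> x \<in> A \<longleftrightarrow> y \<in> B"
      show "(A = {} \<and> B = {}) \<or> (A = X \<and> B = Y)"
      proof -
        have "f 0 \<in> A \<longleftrightarrow> y \<in> B" if "y \<in> Y" for y using AB(3)[OF e[OF that]] .
        moreover have "x \<in> A \<longleftrightarrow> y0 \<in> B" if "x \<in> X" for x using AB(3)[OF e'[OF that]] .
        ultimately show ?thesis using AB(1,2) f0 y0(1) by (cases "f 0 \<in> A") auto
      qed
    qed
  qed
  ultimately show ?thesis using E X by (intro exI[of _ X] exI[of _ Y] exI[of _ E]) (auto simp: Y_def)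
qed

lemma (in optimal_bip) minsq_le_codeg2:
  assumes "card X + card Y = p + size C" "p \<in># C" "\<And>c. c \<in># C \<Longrightarrow> 1 \<le> c \<and> c \<le> p" "\<Sum>\<^sub># C = card E"
  shows "minsq C \<le> codeg2 X E"
proof -
  have "card (X \<union> Y) = p + size C" using assms finX finY dis by (simp add: card_Un_disjoint)
  from realize_degs[OF _ this assms(2,3)] obtain X' Y' E' where
    "X' \<union> Y' = X \<union> Y" "X' \<inter> Y' = {}" "E' \<subseteq> X' \<times> Y'" "bip_connected X' Y' E'"
    "card E' = \<Sum>\<^sub># C" "codeg2 X' E' = minsq C"
    using finX finY by auto
  then show ?thesis using opt[of X' Y' E'] assms(4) by simp
qed

section \<open>Diagrams with at least four columns\<close>

text \<open>The differences to the values at the ends factor, and \<open>0 <= k\<close> orders the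
  cofactors so that at least one difference is nonnegative. The linear case \<open>k = 0\<close> is
  needed too.\<close>

lemma quad_le_max:
  fixes k l r a b x :: real
  assumes "0 \<le> k" "a \<le> x" "x \<le> b"
  shows "k * x\<^sup>2 + l * x + r \<le> max (k * a\<^sup>2 + l * a + r) (k * b\<^sup>2 + l * b + r)"
proof -
  have a: "k * a\<^sup>2 + l * a + r - (k * x\<^sup>2 + l * x + r) = (x - a) * - (k * (a + x) + l)"
    and b: "k * b\<^sup>2 + l * b + r - (k * x\<^sup>2 + l * x + r) = (b - x) * (k * (b + x) + l)"
    by (simp_all add: power2_eq_square algebra_simps)
  have "k * (a + x) \<le> k * (b + x)" using assms by (intro mult_left_mono) auto
  then consider "0 \<le> - (k * (a + x) + l)" | "0 \<le> k * (b + x) + l" by linarith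
  then show ?thesis
  proof cases
    case 1
    then have "0 \<le> (x - a) * - (k * (a + x) + l)" using assms by (intro mult_nonneg_nonneg) auto
    then show ?thesis using a by linarith
  next
    case 2
    then have "0 \<le> (b - x) * (k * (b + x) + l)" using assms by (intro mult_nonneg_nonneg) auto
    then show ?thesis using b by linarith
  qed
qed

text \<open>
  Notation for the bounds on diagrams with \<open>e + 3\<close> columns: \<open>p\<close> is the height of the full columns,
  \<open>A\<close> that of the highest other column, \<open>B\<close> and \<open>Q\<close> are the sum and the sum of squares of the
  remaining heights, and \<open>\<delta>\<close> is the parity of \<open>D\<close>. The two upper bounds for \<open>Q\<close> make the
  total a linear or a convex quadratic function of \<open>A\<close>, to be checked only at the ends of a range.
\<close>

lemma two_full_bound:
  fixes p e w B Q :: real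
  assumes "0 < e" "w < p + e" "B = w + 2 * e" "Q \<le> B * (w - e)"
  shows "4 * p\<^sup>2 + 4 * Q + B\<^sup>2 < 4 * (p + e)\<^sup>2 + 5 * w\<^sup>2"
proof -
  have "e * w < e * (p + e)" using assms by simp
  moreover have "4 * (B * (w - e)) + B\<^sup>2 = 5 * w\<^sup>2 + 8 * (e * w) - 4 * e\<^sup>2"
    unfolding assms(3) by (simp add: power2_eq_square algebra_simps)
  moreover have "4 * (p + e)\<^sup>2 = 4 * p\<^sup>2 + 8 * (e * (p + e)) - 4 * e\<^sup>2"
    by (simp add: power2_eq_square algebra_simps)
  ultimately show ?thesis using assms(4) by linarith
qed

text \<open>With \<open>Q\<close> replaced by its bound, the total is
  \<open>(A + B)^2 + 2 * A * (A + B)\<close> plus a term that \<open>BA\<close> makes nonpositive.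
  Since \<open>A + B\<close> is fixed, this grows with \<open>A\<close>, and the upper limit for
  \<open>A\<close> decides.\<close>

lemma one_full_bound_left:
  fixes p e D A B Q \<delta> :: real
  assumes e: "1 \<le> e" and D: "D < 2 * (p + e)" and AB: "A + B = D + e"
    and Q: "Q \<le> (A + 2) * B - 2 * A * (e + 1)" and BA: "B \<le> A * (e + 1)"
    and \<delta>: "\<delta> = 0 \<or> \<delta> = 1" and A: "2 * A + 2 * e + \<delta> \<le> D" "0 < D"
  shows "p\<^sup>2 + 3 * A\<^sup>2 + 4 * Q + B\<^sup>2 < (p + e)\<^sup>2 + 2 * D\<^sup>2 - \<delta> * (D - 2)"
proof -
  have "3 * A\<^sup>2 + 4 * Q + B\<^sup>2 \<le> 3 * A\<^sup>2 + 4 * ((A + 2) * B - 2 * A * (e + 1)) + B\<^sup>2"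
    using Q by simp
  also have "\<dots> = (A + B)\<^sup>2 + 2 * A * (A + B) + 8 * (B - A * (e + 1))"
    by (simp add: power2_eq_square algebra_simps)
  also have "\<dots> \<le> (D + e)\<^sup>2 + 2 * A * (D + e)" using BA unfolding AB by simp
  also have "\<dots> \<le> (D + e)\<^sup>2 + (D - 2 * e - \<delta>) * (D + e)"
    using A e by (intro add_left_mono mult_right_mono) auto
  also have "\<dots> = 2 * D\<^sup>2 + D * e - e\<^sup>2 - \<delta> * (D + e)"
    by (simp add: power2_eq_square algebra_simps)
  finally have U: "p\<^sup>2 + 3 * A\<^sup>2 + 4 * Q + B\<^sup>2 \<le> p\<^sup>2 + 2 * D\<^sup>2 + D * e - e\<^sup>2 - \<delta> * (D + e)" by simp
  have "D * e < 2 * (p + e) * e" using D e by (intro mult_strict_right_mono) auto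
  moreover have "(p + e)\<^sup>2 = p\<^sup>2 + 2 * (p + e) * e - e\<^sup>2" by (simp add: power2_eq_square algebra_simps)
  moreover have "0 \<le> \<delta> * (D + e) - \<delta> * (D - 2)" using \<delta> e by auto
  ultimately show ?thesis using U by linarith
qed

text \<open>The left-hand side is the total at \<open>2 * A = D - e\<close>, that is
  \<open>A = B - 2 * e\<close>. There the two bounds for \<open>Q\<close> agree: \<open>e\<close>
  heights 2 and one height \<open>A\<close> attain both.\<close>

lemma one_full_bound_mid:
  fixes p e D \<delta> :: real
  assumes e: "1 \<le> e" and p: "e + 4 \<le> p" and D: "p + e + 3 \<le> D" and \<delta>: "\<delta> = 0 \<or> \<delta> = 1"
  shows "p\<^sup>2 + 2 * D\<^sup>2 - 2 * D * e + 4 * e\<^sup>2 + 16 * e < (p + e)\<^sup>2 + 2 * D\<^sup>2 - \<delta> * (D - 2)"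
proof -
  have "0 \<le> (e - 1) * (2 * p + 2 * D - 3 * e - 16)" using e p D by (intro mult_nonneg_nonneg) auto
  moreover have "(p + e)\<^sup>2 + 2 * D\<^sup>2 - (p\<^sup>2 + 2 * D\<^sup>2 - 2 * D * e + 4 * e\<^sup>2 + 16 * e) =
    (e - 1) * (2 * p + 2 * D - 3 * e - 16) + (2 * p + 2 * D - 3 * e - 16)"
    by (simp add: power2_eq_square algebra_simps)
  moreover have "\<delta> * (D - 2) < 2 * p + 2 * D - 3 * e - 16" using \<delta> e p D by auto
  ultimately show ?thesis by linarith
qed

text \<open>In this range \<open>B - 2 * e <= A\<close>, so the remaining sum may be concentrated in
  one column. The resulting total is convex in \<open>A\<close>: its left end is
  \<open>one_full_bound_mid\<close>, and at its right end \<open>A = p\<close> there is a second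
  full column, whence the comparison with two full columns and one of height
  \<open>w\<close>.\<close>

lemma one_full_bound_right:
  fixes p e w D A B Q \<delta> :: real
  assumes e: "1 \<le> e" and p: "e + 4 \<le> p" and w: "3 \<le> w" "w \<le> p + e - 1" and D: "D = p + e + w"
    and AB: "A + B = D + e" and Q: "Q \<le> (B - 2 * e)\<^sup>2 + 4 * e"
    and \<delta>: "\<delta> = 0 \<or> \<delta> = 1" and A: "D - e \<le> 2 * A" "A \<le> p"
  shows "p\<^sup>2 + 3 * A\<^sup>2 + 4 * Q + B\<^sup>2 < 4 * (p + e)\<^sup>2 + 5 * w\<^sup>2 \<or>
    p\<^sup>2 + 3 * A\<^sup>2 + 4 * Q + B\<^sup>2 < (p + e)\<^sup>2 + 2 * D\<^sup>2 - \<delta> * (D - 2)"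
proof -
  define r where "r = (D + e)\<^sup>2 + 4 * (D - e)\<^sup>2 + p\<^sup>2 + 16 * e"
  let ?f = "\<lambda>x. 8 * x\<^sup>2 + (6 * e - 10 * D) * x + r"
  have f: "p\<^sup>2 + 3 * x\<^sup>2 + 4 * ((D + e - x - 2 * e)\<^sup>2 + 4 * e) + (D + e - x)\<^sup>2 = ?f x" for x
    unfolding r_def by (simp add: power2_eq_square algebra_simps)
  have B: "B = D + e - A" using AB by simp
  have "p\<^sup>2 + 3 * A\<^sup>2 + 4 * Q + B\<^sup>2 \<le> ?f A"
    using Q unfolding f[symmetric] B by simp
  also have "\<dots> \<le> max (?f ((D - e) / 2)) (?f p)"
    using A by (intro quad_le_max) auto
  finally have U: "p\<^sup>2 + 3 * A\<^sup>2 + 4 * Q + B\<^sup>2 \<le> max (?f ((D - e) / 2)) (?f p)" .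
  have "?f ((D - e) / 2) = p\<^sup>2 + 2 * D\<^sup>2 - 2 * D * e + 4 * e\<^sup>2 + 16 * e"
    unfolding r_def by (simp add: power2_eq_square field_simps)
  then have 1: "?f ((D - e) / 2) < (p + e)\<^sup>2 + 2 * D\<^sup>2 - \<delta> * (D - 2)"
    using one_full_bound_mid[OF e p _ \<delta>, of D] D w by simp
  have "e * (w + 4) < e * (2 * p)" using e p w by (intro mult_strict_left_mono) auto
  moreover have "?f p = 4 * (p + e)\<^sup>2 + 5 * w\<^sup>2 + 4 * (e * (w + 4)) - 4 * (e * (2 * p))"
    unfolding r_def D by (simp add: power2_eq_square algebra_simps)
  ultimately have 2: "?f p < 4 * (p + e)\<^sup>2 + 5 * w\<^sup>2" by linarith
  show ?thesis using U 1 2 by linarith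
qed

text \<open>Between the two other ranges the interval bound for \<open>Q\<close> is used; with
  \<open>A + B\<close> fixed the squares of \<open>A\<close> cancel and the total is linear.\<close>

lemma one_full_bound_middle:
  fixes p e D A B Q \<delta> :: real
  assumes e: "1 \<le> e" and p: "e + 4 \<le> p" and D: "p + e + 3 \<le> D" "D < 2 * (p + e)"
    and AB: "A + B = D + e" and Q: "Q \<le> (A + 2) * B - 2 * A * (e + 1)"
    and \<delta>: "\<delta> = 0 \<or> \<delta> = 1" and A: "D - 2 * e + \<delta> \<le> 2 * A" "2 * A \<le> D - e"
  shows "p\<^sup>2 + 3 * A\<^sup>2 + 4 * Q + B\<^sup>2 < (p + e)\<^sup>2 + 2 * D\<^sup>2 - \<delta> * (D - 2)"
proof -
  define r where "r = p\<^sup>2 + (D + e)\<^sup>2 + 8 * (D + e)"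
  let ?f = "\<lambda>x. 0 * x\<^sup>2 + (2 * (D + e) - 8 * (e + 2)) * x + r"
  have B: "B = D + e - A" using AB by simp
  have "p\<^sup>2 + 3 * A\<^sup>2 + 4 * Q + B\<^sup>2 \<le> p\<^sup>2 + 3 * A\<^sup>2 + 4 * ((A + 2) * B - 2 * A * (e + 1)) + B\<^sup>2"
    using Q by simp
  also have "\<dots> = ?f A"
    unfolding B r_def by (simp add: power2_eq_square algebra_simps)
  also have "\<dots> \<le> max (?f ((D - 2 * e + \<delta>) / 2)) (?f ((D - e) / 2))"
    using A by (intro quad_le_max) auto
  finally have U: "p\<^sup>2 + 3 * A\<^sup>2 + 4 * Q + B\<^sup>2 \<le> max (?f ((D - 2 * e + \<delta>) / 2)) (?f ((D - e) / 2))" .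
  have "?f ((D - e) / 2) = p\<^sup>2 + 2 * D\<^sup>2 - 2 * D * e + 4 * e\<^sup>2 + 16 * e"
    unfolding r_def by (simp add: power2_eq_square field_simps)
  then have 1: "?f ((D - e) / 2) < (p + e)\<^sup>2 + 2 * D\<^sup>2 - \<delta> * (D - 2)"
    using one_full_bound_mid[OF e p D(1) \<delta>] by simp
  have "?f ((D - 2 * e + \<delta>) / 2) < (p + e)\<^sup>2 + 2 * D\<^sup>2 - \<delta> * (D - 2)"
    using \<delta>
  proof
    assume [simp]: "\<delta> = 0"
    have "(p + e)\<^sup>2 + 2 * D\<^sup>2 - ?f ((D - 2 * e) / 2) =
        e * (2 * (p + e) - D) + 4 * (e * (D - 2 * e - 6))"
      unfolding r_def by (simp add: power2_eq_square field_simps)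
    moreover have "0 < e * (2 * (p + e) - D)" "0 \<le> e * (D - 2 * e - 6)"
      using e p D by (auto intro!: mult_pos_pos mult_nonneg_nonneg)
    ultimately show ?thesis by simp
  next
    assume [simp]: "\<delta> = 1"
    \<comment> \<open>The slack is split so that every term is nonnegative by
      \<open>e + 4 <= p\<close> and its consequence \<open>2 * e + 7 <= D\<close>.\<close>
    have "(p + e)\<^sup>2 + 2 * D\<^sup>2 - (D - 2) - ?f ((D - 2 * e + 1) / 2) =
        2 * (e * (p - e - 4)) + (3 * e - 2) * (D - 2 * e - 7) + (2 * (e - 1) * (e + 3) + 2)"
      unfolding r_def by (simp add: power2_eq_square field_simps)
    moreover have "0 \<le> e * (p - e - 4)" "0 \<le> (3 * e - 2) * (D - 2 * e - 7)" "0 \<le> 2 * (e - 1) * (e + 3)"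
      using e p D by (auto intro!: mult_nonneg_nonneg)
    ultimately show ?thesis by simp
  qed
  then show ?thesis using U 1 by linarith
qed

text \<open>The estimates are real because the ends of the ranges may be half-integers. Integrality
  enters only through \<open>\<delta>\<close>: for odd \<open>D\<close> the number
  \<open>2 * A + 2 * e\<close> cannot equal \<open>D\<close>, so the ranges on its two sides can be
  kept apart by 1.\<close>

lemma one_full_bound:
  fixes p e w A B Q :: int
  assumes e: "1 \<le> e" and p: "e + 4 \<le> p" and w: "3 \<le> w" "w < p + e"
    and AB: "A + B = p + 2 * e + w" and A: "A \<le> p" and BA: "B \<le> A * (e + 1)"
    and Q1: "Q \<le> (A + 2) * B - 2 * A * (e + 1)" and Q2: "Q \<le> (B - 2 * e)\<^sup>2 + 4 * e"
  defines "U \<equiv> p\<^sup>2 + 3 * A\<^sup>2 + 4 * Q + B\<^sup>2" and "D \<equiv> p + e + w"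
  shows "U < 4 * (p + e)\<^sup>2 + 5 * w\<^sup>2 \<or>
    U < (p + e)\<^sup>2 + 2 * D\<^sup>2 - (if even D then 0 else D - 2)"
proof -
  define \<delta> :: int where "\<delta> = (if even D then 0 else 1)"
  have \<delta>: "real_of_int \<delta> = 0 \<or> real_of_int \<delta> = 1" by (simp add: \<delta>_def)
  note rl = of_int_less_iff[where 'a = real, symmetric] of_int_le_iff[where 'a = real, symmetric]
  have r: "real_of_int A + real_of_int B = real_of_int D + real_of_int e"
    "1 \<le> real_of_int e" "real_of_int e + 4 \<le> real_of_int p"
    "real_of_int D < 2 * (real_of_int p + real_of_int e)" "0 < real_of_int D"
    "real_of_int p + real_of_int e + 3 \<le> real_of_int D"
    "real_of_int Q \<le> (real_of_int A + 2) * real_of_int B - 2 * real_of_int A * (real_of_int e + 1)"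
    "real_of_int Q \<le> (real_of_int B - 2 * real_of_int e)\<^sup>2 + 4 * real_of_int e"
    "real_of_int B \<le> real_of_int A * (real_of_int e + 1)"
    "real_of_int D = real_of_int p + real_of_int e + real_of_int w"
    "3 \<le> real_of_int w" "real_of_int w \<le> real_of_int p + real_of_int e - 1" "real_of_int A \<le> real_of_int p"
    using Q1[unfolded rl] Q2[unfolded rl] BA[unfolded rl] e p w AB A by (simp_all add: D_def)
  have eq: "real_of_int ((p + e)\<^sup>2 + 2 * D\<^sup>2 - (if even D then 0 else D - 2)) =
    (real_of_int p + real_of_int e)\<^sup>2 + 2 * (real_of_int D)\<^sup>2 - real_of_int \<delta> * (real_of_int D - 2)"
    by (simp add: \<delta>_def)
  have eqU: "real_of_int U = (real_of_int p)\<^sup>2 + 3 * (real_of_int A)\<^sup>2 + 4 * real_of_int Q + (real_of_int B)\<^sup>2"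
    and eq1: "real_of_int (4 * (p + e)\<^sup>2 + 5 * w\<^sup>2) =
      4 * (real_of_int p + real_of_int e)\<^sup>2 + 5 * (real_of_int w)\<^sup>2"
    by (simp_all add: U_def)
  consider "2 * A + 2 * e + \<delta> \<le> D" | "D - 2 * e + \<delta> \<le> 2 * A" "2 * A \<le> D - e" | "D - e \<le> 2 * A"
  proof -
    have "2 * A + 2 * e + \<delta> \<le> D \<or> D + \<delta> \<le> 2 * A + 2 * e"
    proof (cases "even D")
      case False
      then obtain k where "D = 2 * k + 1" by (auto elim: oddE)
      then show ?thesis by (simp add: \<delta>_def) arith
    qed (auto simp: \<delta>_def)
    then show ?thesis using that by linarith
  qed
  then show ?thesis
  proof cases
    case 1
    then have "2 * real_of_int A + 2 * real_of_int e + real_of_int \<delta> \<le> real_of_int D" by linarith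
    from one_full_bound_left[OF r(2,4,1,7,9) \<delta> this r(5)]
    show ?thesis unfolding rl(1) eq eqU by simp
  next
    case 2
    then have "real_of_int D - 2 * real_of_int e + real_of_int \<delta> \<le> 2 * real_of_int A"
      "2 * real_of_int A \<le> real_of_int D - real_of_int e" by linarith+
    from one_full_bound_middle[OF r(2,3,6,4,1,7) \<delta> this]
    show ?thesis unfolding rl(1) eq eqU by simp
  next
    case 3
    then have "real_of_int D - real_of_int e \<le> 2 * real_of_int A" by linarith
    from one_full_bound_right[OF r(2,3,11,12,10,1,8) \<delta> this r(13)]
    show ?thesis unfolding rl(1) eq eqU eq1 by simp
  qed
qed

text \<open>The heights of a diagram with \<open>p\<close> rows, a full column and no empty one;
  \<open>realize_degs\<close> turns exactly such multisets into connected graphs.\<close>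

definition admissible :: "nat \<Rightarrow> nat multiset \<Rightarrow> bool" where
  "admissible p C \<longleftrightarrow> p \<in># C \<and> (\<forall>c\<in>#C. 1 \<le> c \<and> c \<le> p)"

text \<open>Only the number of vertices \<open>p + size C\<close> is kept, not the sizes of the
  sides: a competitor may trade columns for rows.\<close>

definition improvable :: "nat \<Rightarrow> nat multiset \<Rightarrow> bool" where
  "improvable p C \<longleftrightarrow> (\<exists>p' C'. admissible p' C' \<and> p' + size C' = p + size C \<and>
     \<Sum>\<^sub># C' = \<Sum>\<^sub># C \<and> minsq C < minsq C')"

text \<open>
  The lowest column, of height \<open>s\<close>, is turned into a new row that lengthens \<open>s\<close> full columns.
\<close>

lemma improvable_short_column:
  assumes adm: "admissible p C" and s: "s \<in># C" "\<And>c. c \<in># C \<Longrightarrow> s \<le> c" "s < p"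
    and full: "s \<le> count C p" and size: "size C \<le> p"
  shows "improvable p C"
proof -
  have s1: "1 \<le> s" using adm s by (auto simp: admissible_def)
  obtain C1 where C1: "C = add_mset s C1" using multi_member_split[OF s(1)] by blast
  have "s \<le> count C1 p" using full s(3) by (simp add: C1)
  then have "replicate_mset s p \<subseteq># C1" by (simp add: count_le_replicate_mset_subset_eq)
  then obtain R where R: "C1 = replicate_mset s p + R" by (metis subset_mset.add_diff_inverse)
  have RC: "b \<in># R \<Longrightarrow> 1 \<le> b \<and> b \<le> p" for b using adm by (simp add: admissible_def C1 R)
  let ?C = "replicate_mset s (p + 1) + R"
  define Q where "Q = (\<Sum>b\<in>#R. b\<^sup>2)"
  have "minsq C = minsq C1 + s\<^sup>2 * (2 * size C1 + 1)"
    unfolding C1 by (rule minsq_add_min) (use s in \<open>simp add: C1\<close>)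
  also have "minsq C1 = minsq R + s\<^sup>2 * p\<^sup>2 + 2 * s * Q"
    unfolding R Q_def by (rule minsq_replicate_max) (use RC in auto)
  finally have mC: "minsq C = minsq R + s\<^sup>2 * p\<^sup>2 + 2 * s * Q + s\<^sup>2 * (2 * size C1 + 1)" .
  have "minsq ?C = minsq R + s\<^sup>2 * (p + 1)\<^sup>2 + 2 * s * Q"
    unfolding Q_def by (rule minsq_replicate_max) (use RC in \<open>force\<close>)
  then have "minsq ?C = minsq R + s\<^sup>2 * p\<^sup>2 + 2 * s * Q + s\<^sup>2 * (2 * p + 1)"
    by (simp add: power2_eq_square algebra_simps)
  \<comment> \<open>Loss from the removed column against gain from the new row;
    \<open>size C <= p\<close> makes the gain strictly larger.\<close>
  moreover have "s\<^sup>2 * (2 * size C1 + 1) < s\<^sup>2 * (2 * p + 1)"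
    using size s1 by (intro mult_strict_left_mono) (auto simp: C1)
  ultimately have less: "minsq C < minsq ?C" using mC by linarith
  have "admissible (p + 1) ?C"
    using s1 RC by (fastforce simp: admissible_def split: if_splits)
  moreover have "p + 1 + size ?C = p + size C" "\<Sum>\<^sub># ?C = \<Sum>\<^sub># C"
    by (simp_all add: C1 R algebra_simps)
  ultimately show ?thesis unfolding improvable_def using less by blast
qed

text \<open>The weights 1, 3, 5 count the ordered pairs of columns whose minimum is the height in
  question.\<close>

lemma minsq_three:
  assumes "b \<le> a" "a \<le> p"
  shows "minsq {#p, a, b#} = p\<^sup>2 + 3 * a\<^sup>2 + 5 * b\<^sup>2"
  using assms by (simp add: minsq_def min_absorb1 min_absorb2)

text \<open>The sum of \<open>(A - b) * (b - 2) >= 0\<close> over all heights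
  \<open>b\<close>.\<close>

lemma sum_mset_sq_le_interval:
  assumes "\<And>b. b \<in># R \<Longrightarrow> 2 \<le> b \<and> b \<le> A"
  shows "int (\<Sum>b\<in>#R. b\<^sup>2) \<le> (int A + 2) * int (\<Sum>\<^sub># R) - 2 * int A * int (size R)"
  using assms
proof (induction R)
  case (add x R)
  have "0 \<le> (int A - int x) * (int x - 2)" using add.prems[of x] by (intro mult_nonneg_nonneg) auto
  then have "(int x)\<^sup>2 \<le> (int A + 2) * int x - 2 * int A"
    by (simp add: power2_eq_square algebra_simps)
  moreover have "int (\<Sum>b\<in>#R. b\<^sup>2) \<le> (int A + 2) * int (\<Sum>\<^sub># R) - 2 * int A * int (size R)"
    using add by simp
  ultimately show ?case by (simp add: algebra_simps)
qed simp

text \<open>The excesses \<open>b - 2\<close> are nonnegative, so the sum of their squares is at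
  most the square of their sum. The first part shares the induction because it gives the sign of the
  total excess \<open>T\<close>.\<close>

lemma sum_mset_sq_le_concentrated:
  assumes "\<And>b. b \<in># R \<Longrightarrow> 2 \<le> b"
  shows "2 * size R \<le> \<Sum>\<^sub># R"
    and "int (\<Sum>b\<in>#R. b\<^sup>2) + 4 * int (size R) \<le>
      (int (\<Sum>\<^sub># R) - 2 * int (size R))\<^sup>2 + 4 * int (\<Sum>\<^sub># R)"
  using assms
proof (induction R)
  case (add x R)
  {
    case 1 then show ?case using add.IH(1) by fastforce
  next
    case 2
    define T where "T = int (\<Sum>\<^sub># R) - 2 * int (size R)"
    have "2 * size R \<le> \<Sum>\<^sub># R" using add.IH(1) 2 by simp
    then have "0 \<le> T" unfolding T_def by linarith
    then have a: "0 \<le> T * (int x - 2)" using 2[of x] by simp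
    have b: "int (\<Sum>b\<in>#R. b\<^sup>2) + 4 * int (size R) \<le> T\<^sup>2 + 4 * int (\<Sum>\<^sub># R)"
      using add.IH(2) 2 unfolding T_def by simp
    have T: "int x + int (\<Sum>\<^sub># R) - 2 * (int (size R) + 1) = T + (int x - 2)"
      unfolding T_def by simp
    have c: "(T + (int x - 2))\<^sup>2 = T\<^sup>2 + 2 * (T * (int x - 2)) + (int x)\<^sup>2 - 4 * int x + 4"
      by (simp add: power2_eq_square algebra_simps)
    have eq: "int (\<Sum>b\<in>#add_mset x R. b\<^sup>2) = (int x)\<^sup>2 + int (\<Sum>b\<in>#R. b\<^sup>2)"
      "int (\<Sum>\<^sub># (add_mset x R)) = int x + int (\<Sum>\<^sub># R)"
      "int (size (add_mset x R)) = int (size R) + 1" by simp_all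
    have "(int x)\<^sup>2 + int (\<Sum>b\<in>#R. b\<^sup>2) + 4 * (int (size R) + 1) \<le>
      (T + (int x - 2))\<^sup>2 + 4 * (int x + int (\<Sum>\<^sub># R))"
      unfolding c using add_mono[OF a b] a by (simp del: of_nat_sum_mset add: algebra_simps)
    then show ?case unfolding eq T .
  }
qed auto

lemma sum_mset_ge_size:
  assumes "\<And>b. b \<in># R \<Longrightarrow> s \<le> b"
  shows "s * size R \<le> (\<Sum>\<^sub># R :: nat)"
  using assms by (induction R) (auto simp: add_mono)

lemma sum_mset_le_size:
  assumes "\<And>b. b \<in># R \<Longrightarrow> b \<le> s"
  shows "(\<Sum>\<^sub># R :: nat) \<le> s * size R"
  using assms by (induction R) (auto simp: add_mono)

text \<open>
  The competitors have three columns: with \<open>P = p + e\<close> rows, either two full columns and one of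
  height \<open>w\<close>, or one full column and the rest distributed as evenly as possible.
\<close>

lemma improvable_three_columns:
  fixes p e w :: nat
  assumes size: "size C = e + 3" and sum: "\<Sum>\<^sub># C = 2 * (p + e) + w" and w: "1 \<le> w" "w < p + e"
    and less: "int (minsq C) < 4 * (int p + int e)\<^sup>2 + 5 * (int w)\<^sup>2 \<or>
      int (minsq C) < (int p + int e)\<^sup>2 + 2 * (int p + int e + int w)\<^sup>2
        - (if even (int p + int e + int w) then 0 else int p + int e + int w - 2)"
  shows "improvable p C"
proof -
  let ?P = "p + e"
  have imp: "improvable p C"
    if "b \<le> a" "a \<le> ?P" "1 \<le> b" "a + b = ?P + w" "int (minsq C) < (int ?P)\<^sup>2 + 3 * (int a)\<^sup>2 + 5 * (int b)\<^sup>2"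
    for a b
  proof -
    have "int (minsq C) < int (minsq {#?P, a, b#})"
      unfolding minsq_three[OF that(1,2)] using that(5) by simp
    moreover have "admissible ?P {#?P, a, b#}" using that by (auto simp: admissible_def)
    ultimately show ?thesis unfolding improvable_def
      using that size sum by (intro exI[of _ ?P] exI[of _ "{#?P, a, b#}"]) simp
  qed
  show ?thesis
  proof (cases "int (minsq C) < 4 * (int p + int e)\<^sup>2 + 5 * (int w)\<^sup>2")
    case True
    then show ?thesis using w by (intro imp[of w ?P]) auto
  next
    case False
    with less have l: "int (minsq C) < (int p + int e)\<^sup>2 + 2 * (int p + int e + int w)\<^sup>2
        - (if even (int p + int e + int w) then 0 else int p + int e + int w - 2)" by blast
    show ?thesis
    proof (cases "even (?P + w)")
      case True
      then obtain u where u: "?P + w = 2 * u" by (rule evenE)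
      then have iu: "int p + int e + int w = 2 * int u" by linarith
      have "(2 * int u)\<^sup>2 = 4 * (int u)\<^sup>2" by (simp add: power2_eq_square)
      then show ?thesis using l w u unfolding iu by (intro imp[of u u]) auto
    next
      case False
      then obtain u where u: "?P + w = 2 * u + 1" by (rule oddE)
      then have iu: "int p + int e + int w = 2 * int u + 1" by linarith
      \<comment> \<open>The most even split of an odd \<open>?P + w\<close> has heights
        \<open>u + 1\<close> and \<open>u\<close>; it falls short of \<open>2 * (?P + w)^2\<close>
        by \<open>?P + w - 2\<close>.\<close>
      have "2 * (2 * int u + 1)\<^sup>2 - (2 * int u + 1 - 2) = 3 * (int (u + 1))\<^sup>2 + 5 * (int u)\<^sup>2"
        by (simp add: power2_eq_square algebra_simps)
      then show ?thesis using l w u unfolding iu by (intro imp[of u "u + 1"]) auto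
    qed
  qed
qed

text \<open>By \<open>short\<close> all heights exceed the number \<open>d\<close> of full columns.
  This gives the lower bounds 3 for \<open>d = 2\<close> and 2 for \<open>d = 1\<close> on the
  remaining heights, from which the constants in the estimates of \<open>Q\<close> come.\<close>

lemma improvable_many_columns:
  fixes p e w :: nat
  assumes adm: "admissible p C" and size: "size C = e + 3" and e: "1 \<le> e" and p: "e + 4 \<le> p"
    and sum: "\<Sum>\<^sub># C = 2 * (p + e) + w" and w: "3 \<le> w" "w < p + e"
    and short: "\<And>c. c \<in># C \<Longrightarrow> count C p < c"
  shows "improvable p C"
proof -
  define d where "d = count C p"
  have d1: "1 \<le> d" using adm by (simp add: d_def admissible_def Suc_le_eq)
  have le: "c \<in># C \<Longrightarrow> c \<le> p" for c using adm by (simp add: admissible_def)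
  have split: "\<exists>R. C = replicate_mset k p + R" if "k \<le> d" for k
    using that unfolding d_def by (metis count_le_replicate_mset_subset_eq subset_mset.add_diff_inverse)
  consider "3 \<le> d" | "d = 2" | "d = 1" using d1 by linarith
  then show ?thesis
  proof cases
    case 1
    then obtain R where R: "C = replicate_mset 3 p + R" using split by blast
    \<comment> \<open>Three full columns and \<open>e\<close> further ones of height at least 3
      would need \<open>3 * (p + e)\<close> edges, more than there are.\<close>
    have "3 * size R \<le> \<Sum>\<^sub># R"
      using short 1 unfolding d_def[symmetric] R by (intro sum_mset_ge_size) fastforce
    then have False using sum size w unfolding R by simp
    then show ?thesis ..
  next
    case 2
    then obtain R where R: "C = replicate_mset 2 p + R" using split by blast
    define B Q where "B = \<Sum>\<^sub># R" and "Q = (\<Sum>b\<in>#R. b\<^sup>2)"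
    have R3: "b \<in># R \<Longrightarrow> 3 \<le> b" for b using short 2 unfolding d_def[symmetric] R by fastforce
    have sR: "size R = e + 1" using size R by simp
    have B: "B = w + 2 * e" using sum R unfolding B_def by simp
    \<comment> \<open>The other \<open>e\<close> heights in \<open>R\<close> are at least 3, so none
      exceeds \<open>B - 3 * e\<close>, which is \<open>w - e\<close>.\<close>
    have bB: "b + 3 * e \<le> B" if b: "b \<in># R" for b
    proof -
      obtain R' where R': "R = add_mset b R'" using multi_member_split[OF b] by blast
      have "3 * size R' \<le> \<Sum>\<^sub># R'" using R3 R' by (intro sum_mset_ge_size) auto
      then show ?thesis using sR R' by (simp add: B_def)
    qed
    have "b \<le> B - 3 * e" if "b \<in># R" for b using bB[OF that] by simp
    then have "Q \<le> (\<Sum>b\<in>#R. (B - 3 * e) * b)"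
      unfolding Q_def power2_eq_square by (intro sum_mset_mono mult_right_mono) auto
    also have "\<dots> = (B - 3 * e) * B" unfolding B_def sum_mset_distrib_left[symmetric] by simp
    finally have "int Q \<le> int ((B - 3 * e) * B)" by (simp only: of_nat_le_iff)
    also have "int ((B - 3 * e) * B) = int (B - 3 * e) * int B" by (rule of_nat_mult)
    finally have Q: "int Q \<le> int (B - 3 * e) * int B" .
    have "R \<noteq> {#}" using sR by auto
    then have "3 * e \<le> B" using bB by (auto elim!: multiset_nonemptyE dest: add_leE)
    then have "int (B - 3 * e) = int w - int e" using B by linarith
    with Q have Q: "int Q \<le> int B * (int w - int e)" by (simp only: mult.commute)
    have "minsq C = minsq R + 2\<^sup>2 * p\<^sup>2 + 2 * 2 * Q"
      unfolding R Q_def by (rule minsq_replicate_max) (use le R in auto)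
    then have "minsq C \<le> 4 * p\<^sup>2 + 4 * Q + B\<^sup>2" using minsq_le[of R] by (simp add: B_def)
    then have "int (minsq C) \<le> 4 * (int p)\<^sup>2 + 4 * int Q + (int B)\<^sup>2"
      unfolding of_nat_le_iff[where 'a = int, symmetric] by simp
    moreover have "4 * (real p)\<^sup>2 + 4 * real Q + (real B)\<^sup>2 < 4 * (real p + real e)\<^sup>2 + 5 * (real w)\<^sup>2"
    proof (rule two_full_bound)
      have "real_of_int (int Q) \<le> real_of_int (int B * (int w - int e))" using Q of_int_le_iff by blast
      then show "real Q \<le> real B * (real w - real e)" by simp
    qed (use e w B in auto)
    then have "real_of_int (4 * (int p)\<^sup>2 + 4 * int Q + (int B)\<^sup>2) <
      real_of_int (4 * (int p + int e)\<^sup>2 + 5 * (int w)\<^sup>2)" by simp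
    then have "4 * (int p)\<^sup>2 + 4 * int Q + (int B)\<^sup>2 < 4 * (int p + int e)\<^sup>2 + 5 * (int w)\<^sup>2"
      by (simp only: of_int_less_iff)
    ultimately have "int (minsq C) < 4 * (int p + int e)\<^sup>2 + 5 * (int w)\<^sup>2" by linarith
    then show ?thesis using w by (intro improvable_three_columns[OF size sum]) auto
  next
    case 3
    obtain C1 where C1: "C = add_mset p C1" using multi_member_split[of p C] adm unfolding admissible_def by blast
    have C1ne: "C1 \<noteq> {#}" using size C1 by auto
    define A where "A = Max_mset C1"
    have A: "A \<in># C1" "\<And>b. b \<in># C1 \<Longrightarrow> b \<le> A" using C1ne by (simp_all add: A_def)
    obtain R where R: "C1 = add_mset A R" using multi_member_split[OF A(1)] by blast
    define B Q where "B = \<Sum>\<^sub># R" and "Q = (\<Sum>b\<in>#R. b\<^sup>2)"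
    have R2: "b \<in># R \<Longrightarrow> 2 \<le> b \<and> b \<le> A" for b
      using short 3 A unfolding d_def[symmetric] C1 R by fastforce
    have sR: "size R = e + 1" using size C1 R by simp
    have AB: "A + B = p + 2 * e + w" using sum unfolding C1 R B_def by simp
    have Ap: "A \<le> p" using le A C1 by simp
    have BA: "int B \<le> int A * (int e + 1)"
      using sum_mset_le_size[of R A] R2 sR unfolding B_def[symmetric]
      by (metis of_nat_1 of_nat_add of_nat_le_iff of_nat_mult)
    have Q1: "int Q \<le> (int A + 2) * int B - 2 * int A * (int e + 1)"
      using sum_mset_sq_le_interval[of R A] R2 sR unfolding Q_def B_def by (simp add: add.commute)
    have Q2: "int Q \<le> (int B - 2 * int e)\<^sup>2 + 4 * int e"
    proof -
      have "int Q + 4 * int (e + 1) \<le> (int B - 2 * int (e + 1))\<^sup>2 + 4 * int B"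
        using sum_mset_sq_le_concentrated(2)[of R] R2 unfolding sR Q_def B_def by blast
      then show ?thesis by (simp add: power2_eq_square algebra_simps)
    qed
    have "minsq C = minsq C1 + p\<^sup>2 + 2 * (A\<^sup>2 + Q)"
      unfolding C1 by (subst minsq_add_max) (use le in \<open>auto simp: C1 R Q_def\<close>)
    also have "minsq C1 = minsq R + A\<^sup>2 + 2 * Q"
      unfolding R Q_def by (rule minsq_add_max) (use R2 in auto)
    finally have "minsq C \<le> p\<^sup>2 + 3 * A\<^sup>2 + 4 * Q + B\<^sup>2" using minsq_le[of R] by (simp add: B_def)
    then have "int (minsq C) \<le> int (p\<^sup>2 + 3 * A\<^sup>2 + 4 * Q + B\<^sup>2)" by (simp only: of_nat_le_iff)
    then have U: "int (minsq C) \<le> (int p)\<^sup>2 + 3 * (int A)\<^sup>2 + 4 * int Q + (int B)\<^sup>2" by simp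
    have i: "1 \<le> int e" "int e + 4 \<le> int p" "3 \<le> int w" "int w < int p + int e"
      "int A + int B = int p + 2 * int e + int w" "int A \<le> int p"
      using e p w AB Ap by linarith+
    show ?thesis
      using one_full_bound[OF i BA Q1 Q2] U w
      by (intro improvable_three_columns[OF size sum]) linarith+
  qed
qed

section \<open>The smaller side\<close>

context optimal_bip
begin

lemma finite_E: "finite E"
  using E finX finY finite_subset by blast

lemma finite_nbhd: "finite (E `` S)" "finite (E\<inverse> `` S)"
  using finite_E by (auto intro: finite_Image)

lemma size_degs: "size (degs Y E) = card Y"
  by (simp add: degs_def)

lemma minsq_degs:
  assumes "E \<noteq> {}"
  shows "minsq (degs Y E) = codeg2 X E"
proof -
  interpret c: optimal_bip Y X "E\<inverse>" by (rule converse)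
  have "minsq (degs Y E) = codeg2 Y (E\<inverse>)"
    using c.nested assms by (intro minsq_degs_nested finY finite_E) auto
  then show ?thesis using codeg2_converse[OF finX finY E] by simp
qed

lemma admissible_degs:
  assumes "E \<noteq> {}"
  shows "admissible (card X) (degs Y E)"
proof -
  interpret c: optimal_bip Y X "E\<inverse>" by (rule converse)
  obtain x where x: "x \<in> X" "E `` {x} = Y" using ex_full_vertex assms by auto
  obtain y where y: "y \<in> Y" "E\<inverse> `` {y} = X" using c.ex_full_vertex assms by auto
  have "card (E\<inverse> `` {v}) \<le> card X" for v using E finX by (intro card_mono) auto
  moreover have "1 \<le> card (E\<inverse> `` {v})" if "v \<in> Y" for v
  proof -
    have "x \<in> E\<inverse> `` {v}" using that x by auto
    then show ?thesis using finite_nbhd(2)[of "{v}"] by (auto simp: Suc_le_eq card_gt_0_iff)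
  qed
  moreover have "card X \<in> (\<lambda>v. card (E\<inverse> `` {v})) ` Y" using y by force
  ultimately show ?thesis using finY by (auto simp: admissible_def degs_def)
qed

lemma not_improvable_degs:
  assumes "E \<noteq> {}"
  shows "\<not> improvable (card X) (degs Y E)"
proof
  assume "improvable (card X) (degs Y E)"
  then obtain p' C' where C': "admissible p' C'" "p' + size C' = card X + size (degs Y E)"
    "\<Sum>\<^sub># C' = \<Sum>\<^sub># (degs Y E)" "minsq (degs Y E) < minsq C'"
    unfolding improvable_def by blast
  have "minsq C' \<le> codeg2 X E"
  proof (rule minsq_le_codeg2)
    show "card X + card Y = p' + size C'" using C'(2) size_degs by simp
    show "p' \<in># C'" "c \<in># C' \<Longrightarrow> 1 \<le> c \<and> c \<le> p'" for c
      using C'(1) by (auto simp: admissible_def)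
    show "\<Sum>\<^sub># C' = card E" using C'(3) sum_degs[OF finX finY E] by simp
  qed
  then show False using C'(4) minsq_degs[OF assms] by simp
qed

text \<open>By nestedness the neighbours of a row of minimal degree are adjacent to every row: they
  are exactly the full columns.\<close>

lemma ex_degree_eq_count_full:
  assumes "E \<noteq> {}"
  shows "\<exists>x\<in>X. card (E `` {x}) = count (degs Y E) (card X)"
proof -
  let ?M = "(\<lambda>x. card (E `` {x})) ` X"
  have "X \<noteq> {}" using assms E by auto
  then have "Min ?M \<in> ?M" using finX by (intro Min_in) auto
  then obtain x where x: "x \<in> X" and Mx: "card (E `` {x}) = Min ?M" by (auto dest: sym)
  have xmin: "E `` {x} \<subseteq> E `` {u}" if u: "u \<in> X" for u
  proof -
    have le: "card (E `` {x}) \<le> card (E `` {u})" unfolding Mx using u finX by (intro Min_le) auto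
    show ?thesis
      using nested[OF assms x u]
    proof
      assume "E `` {u} \<subseteq> E `` {x}"
      then have "E `` {u} = E `` {x}" using card_seteq[OF finite_nbhd(1) _ le] by simp
      then show ?thesis by simp
    qed
  qed
  have full: "card (E\<inverse> `` {y}) = card X \<longleftrightarrow> E\<inverse> `` {y} = X" for y
    using card_subset_eq[OF finX, of "E\<inverse> `` {y}"] E by auto
  have "E `` {x} = {y \<in> Y. card (E\<inverse> `` {y}) = card X}"
    unfolding full using xmin x E by fast
  moreover have "count (degs Y E) (card X) = card {y \<in> Y. card (E\<inverse> `` {y}) = card X}"
    using finY by (simp add: degs_def count_image_mset vimage_def Int_def conj_commute)
  ultimately have "card (E `` {x}) = count (degs Y E) (card X)" by (simp only:)
  then show ?thesis using x by blast
qed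

text \<open>Otherwise \<open>improvable_short_column\<close> applies to the lowest column;
  \<open>nc\<close> ensures that this column is not itself full.\<close>

lemma count_full_less:
  assumes ne: "E \<noteq> {}" and le: "card Y \<le> card X" and nc: "card E < card X * card Y"
    and c: "c \<in># degs Y E"
  shows "count (degs Y E) (card X) < c"
proof -
  let ?C = "degs Y E"
  have Cne: "?C \<noteq> {#}" using c by auto
  define s where "s = Min_mset ?C"
  have s: "s \<in># ?C" "\<And>c. c \<in># ?C \<Longrightarrow> s \<le> c" using Cne by (simp_all add: s_def)
  have "s < card X"
  proof (rule ccontr)
    assume "\<not> s < card X"
    then have "card X * size ?C \<le> \<Sum>\<^sub># ?C" using s(2) by (intro sum_mset_ge_size) fastforce
    then show False using nc sum_degs[OF finX finY E] size_degs by simp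
  qed
  then have "\<not> s \<le> count ?C (card X)"
    using improvable_short_column[OF admissible_degs[OF ne] s] not_improvable_degs[OF ne] le size_degs
    by auto
  then show ?thesis using s(2)[OF c] by simp
qed

lemma card_smaller_side:
  fixes p w :: nat
  assumes n: "card X + card Y = p + 3" and m: "card E = 2 * p + w" and w: "3 \<le> w" "w < p"
    and le: "card Y \<le> card X"
  shows "card Y = 3"
proof -
  have ne: "E \<noteq> {}" using m w by auto
  have mle: "card E \<le> card X * card Y"
    using card_mono[OF _ E] finX finY by (simp add: card_cartesian_product)
  have "3 \<le> card Y"
  proof (rule ccontr)
    assume "\<not> 3 \<le> card Y"
    \<comment> \<open>Two columns of height at most \<open>p + 1\<close> hold fewer than
      \<open>2 * p + w\<close> edges because \<open>3 <= w\<close>; one column or none holds even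
      fewer.\<close>
    then consider "card Y = 0" | "card Y = 1" | "card Y = 2" by linarith
    then show False using mle n m w by cases auto
  qed
  moreover have False if "4 \<le> card Y"
  proof -
    define e where "e = card Y - 3"
    have e: "card Y = e + 3" "1 \<le> e" using that by (simp_all add: e_def)
    have p: "p = card X + e" using n e by simp
    have nc: "card E < card X * card Y"
    proof -
      have "3 * card X + 3 * e \<le> card X * card Y"
      proof -
        have "3 * e \<le> card X * e" using le that by (intro mult_right_mono) auto
        then show ?thesis unfolding e(1) by (simp add: algebra_simps)
      qed
      then show ?thesis using m w p by simp
    qed
    interpret c: optimal_bip Y X "E\<inverse>" by (rule converse)
    have short: "c \<in># degs Y E \<Longrightarrow> count (degs Y E) (card X) < c" for c
      by (rule count_full_less[OF ne le nc])
    \<comment> \<open>\<open>improvable_many_columns\<close> needs \<open>e + 4 <= card X\<close>,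
      so square diagrams are excluded separately. The number of full columns is the length of a
      shortest row and lies below every column height; the same holds with rows and columns
      exchanged, which is contradictory.\<close>
    have "card X \<noteq> card Y"
    proof
      assume eq: "card X = card Y"
      have short': "c \<in># degs X (E\<inverse>) \<Longrightarrow> count (degs X (E\<inverse>)) (card Y) < c" for c
        using ne eq nc by (intro c.count_full_less) (auto simp: card_inverse mult.commute)
      obtain x where x: "x \<in> X" "card (E `` {x}) = count (degs Y E) (card X)"
        using ex_degree_eq_count_full[OF ne] by blast
      obtain y where y: "y \<in> Y" "card (E\<inverse> `` {y}) = count (degs X (E\<inverse>)) (card Y)"
        using c.ex_degree_eq_count_full ne by auto
      have "card (E `` {x}) \<in># degs X (E\<inverse>)" "card (E\<inverse> `` {y}) \<in># degs Y E"
        using x(1) y(1) finX finY by (auto simp: degs_def)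
      then show False using short short' x(2) y(2) by fastforce
    qed
    then have "e + 4 \<le> card X" using le e by simp
    then have "improvable (card X) (degs Y E)"
      using admissible_degs[OF ne] size_degs sum_degs[OF finX finY E] e m w p short
      by (intro improvable_many_columns[of _ _ e w]) auto
    then show False using not_improvable_degs[OF ne] by blast
  qed
  ultimately show ?thesis by (cases "4 \<le> card Y") auto
qed

text \<open>The case \<open>e = 0\<close> of \<open>improvable_three_columns\<close>: a graph with
  three columns is compared with both ends of its own range.\<close>

lemma minsq_degs_ge:
  fixes p w :: nat
  assumes Y: "card Y = 3" and X: "card X = p" and m: "card E = 2 * p + w" and w: "3 \<le> w" "w < p"
  shows "4 * (int p)\<^sup>2 + 5 * (int w)\<^sup>2 \<le> int (minsq (degs Y E))"
    and "(int p)\<^sup>2 + 2 * (int p + int w)\<^sup>2 - (if even (int p + int w) then 0 else int p + int w - 2)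
      \<le> int (minsq (degs Y E))"
proof -
  have ne: "E \<noteq> {}" using m w by auto
  have "\<not> improvable p (degs Y E)" using not_improvable_degs[OF ne] X by simp
  then have "\<not> (int (minsq (degs Y E)) < 4 * (int p + int 0)\<^sup>2 + 5 * (int w)\<^sup>2 \<or>
      int (minsq (degs Y E)) < (int p + int 0)\<^sup>2 + 2 * (int p + int 0 + int w)\<^sup>2
        - (if even (int p + int 0 + int w) then 0 else int p + int 0 + int w - 2))"
    using improvable_three_columns[of "degs Y E" 0 p w] size_degs Y sum_degs[OF finX finY E] m w
    by auto
  then have "4 * (int p)\<^sup>2 + 5 * (int w)\<^sup>2 \<le> int (minsq (degs Y E)) \<and>
      (int p)\<^sup>2 + 2 * (int p + int w)\<^sup>2 - (if even (int p + int w) then 0 else int p + int w - 2)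
        \<le> int (minsq (degs Y E))"
    by (simp only: of_nat_0 add_0_right de_Morgan_disj not_less)
  then show "4 * (int p)\<^sup>2 + 5 * (int w)\<^sup>2 \<le> int (minsq (degs Y E))"
    "(int p)\<^sup>2 + 2 * (int p + int w)\<^sup>2 - (if even (int p + int w) then 0 else int p + int w - 2)
      \<le> int (minsq (degs Y E))" by blast+
qed

end

section \<open>The optimal vectors\<close>

lemma optimal_vector_iff:
  fixes p w :: nat
  shows "optimal_vector (p + 3) (2 * p + w) xs ys \<longleftrightarrow>
    (3 * w < p \<longrightarrow> xs = [real w, real p - real w] \<and> ys = [2, 1]) \<and>
    (3 * w = p \<longrightarrow> xs = [real p / 3, 2 * real p / 3] \<and> ys = [2, 1] \<or>
      xs = [2 * real p / 3, real p / 3] \<and> ys = [1, 2]) \<and>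
    (p < 3 * w \<and> even (p + w) \<longrightarrow>
      xs = [(real p + real w) / 2, (real p - real w) / 2] \<and> ys = [1, 2]) \<and>
    (p < 3 * w \<and> odd (p + w) \<and> 3 * w \<noteq> p + 1 \<and> w + 1 \<noteq> p \<longrightarrow>
      xs = [(real p + real w - 1) / 2, 1, (real p - real w - 1) / 2] \<and> ys = [1, 1, 1]) \<and>
    (3 * w = p + 1 \<longrightarrow> xs = [real w, real p - real w] \<and> ys = [2, 1]) \<and>
    (w + 1 = p \<longrightarrow> xs = [real p - 1, 1] \<and> ys = [2, 1])"
proof -
  have 1: "real (2 * p + w) < 7 * real (p + 3) / 3 - 7 \<longleftrightarrow> 3 * w < p"
    "7 * real (p + 3) / 3 - 7 < real (2 * p + w) \<longleftrightarrow> p < 3 * w"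
    "real (2 * p + w) = 7 * real (p + 3) / 3 - 7 \<longleftrightarrow> 3 * w = p"
    "3 * real (2 * p + w) = 7 * real (p + 3) - 20 \<longleftrightarrow> 3 * w = p + 1"
    "real (2 * p + w) = 3 * real (p + 3) - 10 \<longleftrightarrow> w + 1 = p"
    by (auto simp add: field_simps)
  have 2: "even (3 * int (p + 3) - int (2 * p + w) - 9) \<longleftrightarrow> even (p + w)"
    by (simp add: algebra_simps)
  have 3: "real (2 * p + w) - 2 * real (p + 3) + 6 = real w"
    "3 * real (p + 3) - real (2 * p + w) - 9 = real p - real w"
    "real (p + 3) - 3 = real p" "2 * real (p + 3) - 6 = 2 * real p"
    "real (2 * p + w) - real (p + 3) + 3 = real p + real w"
    "real (2 * p + w) - real (p + 3) + 2 = real p + real w - 1"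
    "3 * real (p + 3) - real (2 * p + w) - 10 = real p - real w - 1"
    "real (p + 3) - 4 = real p - 1"
    by simp_all
  show ?thesis
    unfolding optimal_vector_def Let_def 1 2 3 by blast
qed

text \<open>The comparison with the most even split reads \<open>z * y <= 0\<close> for even
  \<open>p + w\<close> and \<open>(z - 1) * (y - 2) <= 0\<close> for odd \<open>p + w\<close>. Apart
  from \<open>y <= 0\<close> this leaves \<open>y = 1\<close> and \<open>z = 1\<close>, the two
  exceptional values of \<open>m\<close>.\<close>

lemma optimal_vector_21:
  fixes p w :: nat
  assumes w: "w < p"
    and opt: "(int p)\<^sup>2 + 2 * (int p + int w)\<^sup>2 - (if even (int p + int w) then 0 else int p + int w - 2)
      \<le> 4 * (int p)\<^sup>2 + 5 * (int w)\<^sup>2"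
  shows "optimal_vector (p + 3) (2 * p + w) [real w, real p - real w] [2, 1]"
proof -
  define z y where "z = int p - int w" and "y = 3 * int w - int p"
  have eq: "(int p)\<^sup>2 + 2 * (int p + int w)\<^sup>2 = 4 * (int p)\<^sup>2 + 5 * (int w)\<^sup>2 + z * y"
    "2 * (int p + int w) = 4 * z + 2 * y"
    unfolding z_def y_def by (simp_all add: power2_eq_square algebra_simps)
  have z: "0 < z" using w by (simp add: z_def)
  have "3 * w \<le> p" if "even (p + w)"
  proof -
    have "even (int p + int w)" using that by simp
    then have "z * y \<le> 0" using opt eq(1) by simp
    then have "y \<le> 0" using z by (simp add: mult_le_0_iff)
    then show ?thesis by (simp add: y_def)
  qed
  moreover have "3 * w \<le> p + 1 \<or> w + 1 = p" if odd: "odd (p + w)"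
  proof -
    have "odd (int p + int w)" using odd by simp
    then have "z * y \<le> 2 * z + y - 2" using opt eq by simp
    then have "(z - 1) * (y - 2) \<le> 0" by (simp add: algebra_simps)
    then have "z = 1 \<or> y \<le> 2" using z by (auto simp: mult_le_0_iff)
    \<comment> \<open>\<open>y\<close> has the parity of \<open>p + w\<close>.\<close>
    moreover have "y \<noteq> 2" using odd unfolding y_def by presburger
    ultimately show ?thesis unfolding z_def y_def by linarith
  qed
  moreover have "real w = real p / 3 \<and> real p - real w = 2 * real p / 3" if "3 * w = p"
    using that by auto
  moreover have "real w = real p - 1 \<and> real p - real w = 1" if "w + 1 = p" using that by auto
  ultimately show ?thesis
    unfolding optimal_vector_iff
    by (intro conjI impI) (auto simp: not_le[symmetric])
qed

text \<open>The comparison with two full columns gives \<open>(p - w) * (3 * w - p) >= 0\<close>.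
  Equality is the second vector of the tie; the exceptional values do not occur, since they make
  \<open>p + w\<close> odd.\<close>

lemma optimal_vector_12:
  fixes p w a b :: nat
  assumes w: "w < p" and ab: "p = a + b" "2 * a = p + w"
    and opt: "4 * (int p)\<^sup>2 + 5 * (int w)\<^sup>2 \<le> (int p)\<^sup>2 + 8 * (int a)\<^sup>2"
  shows "optimal_vector (p + 3) (2 * p + w) [real a, real b] [1, 2]"
proof -
  have "int p + int w = 2 * int a" using ab by linarith
  then have "8 * (int a)\<^sup>2 = 2 * (int p + int w)\<^sup>2" by (simp add: power2_eq_square)
  then have "0 \<le> (int p - int w) * (3 * int w - int p)"
    using opt by (simp add: power2_eq_square algebra_simps)
  then have "p \<le> 3 * w" using w by (auto simp: zero_le_mult_iff)
  moreover have "even (p + w)" using ab by (metis dvd_triv_left)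
  moreover have "3 * w \<noteq> p + 1" "w + 1 \<noteq> p" using \<open>even (p + w)\<close> by presburger+
  moreover have "real a = (real p + real w) / 2" "real b = (real p - real w) / 2"
    using ab by auto
  moreover have "real a = 2 * real p / 3" "real b = real p / 3" if "3 * w = p"
    using ab that by auto
  ultimately show ?thesis unfolding optimal_vector_iff by auto
qed

text \<open>The heights are \<open>p\<close>, \<open>a + b\<close> and \<open>a\<close>. By
  \<open>opt1\<close> the height \<open>a\<close> is large compared with \<open>b\<close> and
  \<open>c\<close>; then \<open>opt2\<close> forces \<open>b = 1\<close>, as a wider gap could be
  evened out with profit.\<close>

lemma optimal_vector_111:
  fixes p w a b c :: nat
  assumes w: "w < p" and abc: "1 \<le> b" "1 \<le> c" "p = a + b + c" "2 * a + b = p + w"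
    and opt1: "4 * (int p)\<^sup>2 + 5 * (int w)\<^sup>2 \<le> (int p)\<^sup>2 + 3 * (int (a + b))\<^sup>2 + 5 * (int a)\<^sup>2"
    and opt2: "(int p)\<^sup>2 + 2 * (int p + int w)\<^sup>2 - (if even (int p + int w) then 0 else int p + int w - 2)
      \<le> (int p)\<^sup>2 + 3 * (int (a + b))\<^sup>2 + 5 * (int a)\<^sup>2"
  shows "optimal_vector (p + 3) (2 * p + w) [real a, real b, real c] [1, 1, 1]"
proof -
  have iw: "int w = int a - int c" and ip: "int p = int a + int b + int c" using abc by linarith+
  have "0 \<le> int c * (2 * int a - 3 * int b - 4 * int c)"
    using opt1 unfolding iw ip by (simp add: power2_eq_square algebra_simps)
  then have abc4: "3 * int b + 4 * int c \<le> 2 * int a" using abc by (auto simp: zero_le_mult_iff)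
  have D: "int p + int w = 2 * int a + int b" unfolding iw ip by simp
  have "b = 1"
  proof (rule ccontr)
    assume "b \<noteq> 1"
    then have b2: "2 \<le> int b" using abc by linarith
    show False
    proof (cases "even (int p + int w)")
      case True
      then have "0 \<le> int b * (int b - 2 * int a)"
        using opt2 unfolding D by (simp add: power2_eq_square algebra_simps)
      then have "2 * int a \<le> int b" using b2 by (auto simp: zero_le_mult_iff)
      then show False using abc4 abc by linarith
    next
      case False
      then have "0 \<le> (int b - 1) * (int b + 2 - 2 * int a)"
        using opt2 unfolding D by (simp add: power2_eq_square algebra_simps)
      then have "2 * int a \<le> int b + 2" using b2 by (auto simp: zero_le_mult_iff)
      then show False using abc4 abc by linarith
    qed
  qed
  then have "p + w = 2 * a + 1" using abc by simp
  then have "odd (p + w)" by simp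
  moreover have "p + 2 \<le> 3 * w" "w + 1 \<noteq> p" using abc abc4 \<open>b = 1\<close> by linarith+
  moreover have "real a = (real p + real w - 1) / 2" "real c = (real p - real w - 1) / 2"
    using abc \<open>b = 1\<close> by auto
  ultimately show ?thesis using \<open>b = 1\<close> unfolding optimal_vector_iff by auto
qed

section \<open>From vertex bipartitions to column heights\<close>

lemma degs_Un:
  assumes "finite A" "finite B" "A \<inter> B = {}"
  shows "degs (A \<union> B) E = degs A E + degs B E"
  using assms by (simp add: degs_def mset_set_Union)

lemma degs_const:
  assumes "\<And>y. y \<in> A \<Longrightarrow> card (E\<inverse> `` {y}) = d"
  shows "degs A E = replicate_mset (card A) d"
proof (cases "finite A")
  case True
  then have "degs A E = image_mset (\<lambda>_. d) (mset_set A)"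
    unfolding degs_def using assms by (intro image_mset_cong) simp
  then show ?thesis by (simp add: image_mset_const_eq)
qed (simp add: degs_def)

lemma sum_list_card_UN:
  assumes "disjoint_family_on X {1..k}" "\<And>i. i \<in> {1..k} \<Longrightarrow> finite (X i)"
  shows "sum_list (map (\<lambda>i. card (X i)) [1..<k + 1]) = card (\<Union>i\<in>{1..k}. X i)"
proof -
  have "card (\<Union>i\<in>{1..k}. X i) = (\<Sum>i\<in>{1..k}. card (X i))"
    using assms by (intro card_UN_disjoint) (auto simp: disjoint_family_on_def)
  also have "\<dots> = (\<Sum>i\<leftarrow>[1..<k + 1]. card (X i))"
    by (simp only: interv_sum_list_conv_sum_set_nat set_upt Suc_eq_plus1[symmetric] atLeastLessThanSuc_atLeastAtMost)
  finally show ?thesis by simp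
qed

context
  fixes G :: "'a pair_pre_digraph" and k :: nat and X Y :: "nat \<Rightarrow> 'a set"
  assumes vb: "vertex_bipartition G k X Y" and finX: "finite (\<Union>i\<in>{1..k}. X i)"
begin

lemma degree_vertex_bipartition:
  assumes j: "j \<in> {1..k}" and y: "y \<in> Y j"
  shows "card ((parcs G \<inter> (\<Union>i\<in>{1..k}. X i) \<times> (\<Union>j\<in>{1..k}. Y j))\<inverse> `` {y}) =
    (\<Sum>i\<in>{1..k + 1 - j}. card (X i))"
proof -
  have X: "disjoint_family_on X {1..k}"
    and adj: "\<And>i x. i \<in> {1..k} \<Longrightarrow> x \<in> X i \<Longrightarrow> (x, y) \<in> parcs G \<longleftrightarrow> i + j \<le> k + 1"
    using vb j y unfolding vertex_bipartition_def by blast+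
  have sub: "{1..k + 1 - j} \<subseteq> {1..k}" using j by auto
  have "(parcs G \<inter> (\<Union>i\<in>{1..k}. X i) \<times> (\<Union>j\<in>{1..k}. Y j))\<inverse> `` {y} = (\<Union>i\<in>{1..k + 1 - j}. X i)"
    (is "?L = ?R")
  proof
    show "?L \<subseteq> ?R"
    proof
      fix x assume "x \<in> ?L"
      then obtain i where i: "i \<in> {1..k}" "x \<in> X i" "(x, y) \<in> parcs G" by auto
      then have "i + j \<le> k + 1" using adj by blast
      then show "x \<in> ?R" using i by force
    qed
    show "?R \<subseteq> ?L"
    proof
      fix x assume "x \<in> ?R"
      then obtain i where i: "i \<in> {1..k + 1 - j}" "x \<in> X i" by auto
      then have i': "i \<in> {1..k}" "i + j \<le> k + 1" using sub j by auto
      then have "(x, y) \<in> parcs G" using adj[OF i'(1) i(2)] by simp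
      then show "x \<in> ?L" using i(2) i'(1) j y by auto
    qed
  qed
  moreover have "card ?R = (\<Sum>i\<in>{1..k + 1 - j}. card (X i))"
  proof (rule card_UN_disjoint)
    show "\<forall>i\<in>{1..k + 1 - j}. finite (X i)" using finX sub by auto
    show "\<forall>i\<in>{1..k + 1 - j}. \<forall>i'\<in>{1..k + 1 - j}. i \<noteq> i' \<longrightarrow> X i \<inter> X i' = {}"
      using X sub unfolding disjoint_family_on_def by blast
  qed simp
  ultimately show ?thesis by simp
qed

end

locale optimal_in_range = optimal_bip +
  fixes p w :: nat
  assumes n: "card X + card Y = p + 3" and m: "card E = 2 * p + w" and w: "3 \<le> w" "w < p"
    and le: "card Y \<le> card X"
begin

lemma cards: "card Y = 3" "card X = p"
  using card_smaller_side[OF n m w le] n by auto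

lemma ne: "E \<noteq> {}"
  using m w by auto

text \<open>The classes of \<open>Y\<close> are nonempty and \<open>card Y = 3\<close>, so their
  sizes form a composition of 3; each composition gives one shape of the heights.\<close>

lemma optimal_vector_vertex_bipartition:
  assumes vb: "vertex_bipartition G k X' Y'"
    and XY: "X = (\<Union>i\<in>{1..k}. X' i)" "Y = (\<Union>j\<in>{1..k}. Y' j)" and EG: "E = parcs G \<inter> X \<times> Y"
  shows "optimal_vector (p + 3) (2 * p + w)
    (map real (map (\<lambda>i. card (X' i)) [1..<k + 1])) (map real (map (\<lambda>i. card (Y' i)) [1..<k + 1]))"
proof -
  define x y where "x i = card (X' i)" and "y i = card (Y' i)" for i
  have fX: "finite (X' i)" and fY: "finite (Y' i)" if "i \<in> {1..k}" for i
    using that finX finY unfolding XY by (auto intro: finite_subset)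
  have dX: "disjoint_family_on X' {1..k}" and dY: "disjoint_family_on Y' {1..k}"
    using vb by (auto simp: vertex_bipartition_def)
  have pos: "1 \<le> x i" "1 \<le> y i" if "i \<in> {1..k}" for i
    using vb that fX[OF that] fY[OF that] unfolding x_def y_def vertex_bipartition_def
    by (auto simp: Suc_le_eq card_gt_0_iff)
  have sx: "(\<Sum>i\<in>{1..k}. x i) = p"
    unfolding x_def cards(2)[symmetric] XY using fX dX
    by (intro card_UN_disjoint[symmetric]) (auto simp: disjoint_family_on_def)
  have sy: "(\<Sum>i\<in>{1..k}. y i) = 3"
    unfolding y_def cards(1)[symmetric] XY using fY dY
    by (intro card_UN_disjoint[symmetric]) (auto simp: disjoint_family_on_def)
  have deg: "degs (Y' j) E = replicate_mset (y j) (\<Sum>i\<in>{1..k + 1 - j}. x i)" if "j \<in> {1..k}" for j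
    unfolding y_def x_def EG XY
    using degree_vertex_bipartition[OF vb _ that] finX[unfolded XY] by (intro degs_const) blast
  have sum: "\<Sum>\<^sub># (degs Y E) = 2 * p + w" using sum_degs[OF finX finY E] m by simp
  note opt = minsq_degs_ge[OF cards m w]
  have "k \<le> (\<Sum>i\<in>{1..k}. y i)" using sum_mono[of "{1..k}" "\<lambda>_. 1" y] pos by simp
  moreover have "k \<noteq> 0" using sy by (cases k) auto
  ultimately consider "k = 1" | "k = 2" | "k = 3" using sy by linarith
  then show ?thesis
  proof cases
    case 1
    \<comment> \<open>A single class means a complete bipartite graph, whose \<open>3 * p\<close>
      edges are too many for \<open>w < p\<close>.\<close>
    have "Y = Y' 1" using XY(2) 1 by simp
    then have "degs Y E = replicate_mset (y 1) (x 1)" using deg[of 1] 1 by simp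
    then have False using sum sx sy w 1 by simp
    then show ?thesis ..
  next
    case 2
    have k12: "{1..k} = {1, 2}" "{1..k + 1 - 1} = {1, 2}" "{1..k + 1 - 2} = {1 :: nat}"
      using 2 by auto
    have upt: "[1..<k + 1] = [1, 2]" using 2 by (simp add: upt_rec)
    have Y12: "Y = Y' 1 \<union> Y' 2" using XY(2) unfolding k12 by simp
    have dis12: "Y' 1 \<inter> Y' 2 = {}" using dY unfolding k12 by (auto simp: disjoint_family_on_def)
    have D: "degs Y E = replicate_mset (y 1) (x 1 + x 2) + replicate_mset (y 2) (x 1)"
      unfolding Y12 using deg[of 1] deg[of 2] fY[of 1] fY[of 2] dis12
      unfolding k12 by (subst degs_Un) auto
    have sx: "x 1 + x 2 = p" and sy: "y 1 + y 2 = 3" using sx sy unfolding k12 by simp_all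
    have pos: "1 \<le> x 1" "1 \<le> x 2" "1 \<le> y 1" "1 \<le> y 2" using pos unfolding k12 by simp_all
    consider "y 1 = 2" "y 2 = 1" | "y 1 = 1" "y 2 = 2" using sy pos by linarith
    then show ?thesis
    proof cases
      case 1
      have D: "degs Y E = {#p, p, x 1#}" unfolding D sx 1 by (simp add: numeral_eq_Suc)
      have x: "x 1 = w" "real (x 2) = real p - real w" using sum sx unfolding D by auto
      have "minsq (degs Y E) = 4 * p\<^sup>2 + 5 * w\<^sup>2"
        unfolding D x(1) using w by (subst minsq_three) auto
      then have "(int p)\<^sup>2 + 2 * (int p + int w)\<^sup>2 - (if even (int p + int w) then 0 else int p + int w - 2)
          \<le> 4 * (int p)\<^sup>2 + 5 * (int w)\<^sup>2" using opt(2) by simp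
      from optimal_vector_21[OF w(2) this] show ?thesis
        unfolding upt using 1 x by (simp add: x_def y_def)
    next
      case 2
      have D: "degs Y E = {#p, x 1, x 1#}" unfolding D sx 2 by (simp add: numeral_eq_Suc)
      have x: "2 * x 1 = p + w" using sum sx unfolding D by auto
      have "minsq (degs Y E) = p\<^sup>2 + 8 * (x 1)\<^sup>2"
        unfolding D using sx by (subst minsq_three) auto
      then have "4 * (int p)\<^sup>2 + 5 * (int w)\<^sup>2 \<le> (int p)\<^sup>2 + 8 * (int (x 1))\<^sup>2" using opt(1) by simp
      from optimal_vector_12[OF w(2) sx[symmetric] x this] show ?thesis
        unfolding upt using 2 by (simp add: x_def y_def)
    qed
  next
    case 3
    have k123: "{1..k} = {1, 2, 3}" "{1..k + 1 - 1} = {1, 2, 3}" "{1..k + 1 - 2} = {1, 2 :: nat}"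
      "{1..k + 1 - 3} = {1 :: nat}"
      using 3 by auto
    have upt: "[1..<k + 1] = [1, 2, 3]" using 3 by (simp add: upt_rec)
    have Y123: "Y = Y' 1 \<union> (Y' 2 \<union> Y' 3)" using XY(2) unfolding k123 by simp
    have sx: "p = x 1 + x 2 + x 3" and sy: "y 1 + y 2 + y 3 = 3" using sx sy unfolding k123 by simp_all
    have pos: "1 \<le> x 2" "1 \<le> x 3" "1 \<le> y 1" "1 \<le> y 2" "1 \<le> y 3" using pos unfolding k123 by simp_all
    have y: "y 1 = 1" "y 2 = 1" "y 3 = 1" using sy pos by linarith+
    have "Y' 1 \<inter> (Y' 2 \<union> Y' 3) = {}" "Y' 2 \<inter> Y' 3 = {}"
      using dY unfolding k123 by (auto simp: disjoint_family_on_def)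
    then have "degs Y E = degs (Y' 1) E + (degs (Y' 2) E + degs (Y' 3) E)"
      unfolding Y123 using fY[of 1] fY[of 2] fY[of 3] unfolding k123 by (simp add: degs_Un)
    then have D: "degs Y E = {#p, x 1 + x 2, x 1#}"
      using deg[of 1] deg[of 2] deg[of 3] unfolding k123 y sx by (simp add: add.assoc)
    have x: "2 * x 1 + x 2 = p + w" using sum unfolding D by simp
    have "minsq (degs Y E) = p\<^sup>2 + 3 * (x 1 + x 2)\<^sup>2 + 5 * (x 1)\<^sup>2"
      unfolding D using sx by (subst minsq_three) auto
    then have M: "int (minsq (degs Y E)) = (int p)\<^sup>2 + 3 * (int (x 1 + x 2))\<^sup>2 + 5 * (int (x 1))\<^sup>2" by simp
    from optimal_vector_111[OF w(2) pos(1,2) sx x opt[unfolded M]] show ?thesis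
      unfolding upt using y by (simp add: x_def y_def)
  qed
qed

text \<open>The neighbourhoods form a chain \<open>N z\<close>, \<open>N y\<close>,
  \<open>N a = X\<close>, and columns with the same neighbourhood are merged into one class. A full
  row makes \<open>N z\<close> nonempty and \<open>w < p\<close> makes it a proper subset of
  \<open>X\<close>, so no class of \<open>X\<close> is empty.\<close>

lemma ex_vertex_bipartition:
  assumes b: "bipartition G X Y" and EG: "E = parcs G \<inter> X \<times> Y"
  shows "\<exists>k X' Y'. vertex_bipartition G k X' Y' \<and> X = (\<Union>i\<in>{1..k}. X' i) \<and> Y = (\<Union>j\<in>{1..k}. Y' j)"
proof -
  interpret c: optimal_bip Y X "E\<inverse>" by (rule converse)
  define N where "N y = E\<inverse> `` {y}" for y
  have adj: "(x, y) \<in> parcs G \<longleftrightarrow> x \<in> N y" if "x \<in> X" "y \<in> Y" for x y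
    using that by (auto simp: N_def EG)
  have NX: "N y \<subseteq> X" for y using E by (auto simp: N_def)
  obtain a where a: "a \<in> Y" "N a = X" using c.ex_full_vertex ne by (auto simp: N_def)
  have "card (Y - {a}) = 2" using a cards finY by simp
  then obtain u v where uv: "Y - {a} = {u, v}" "u \<noteq> v" by (auto simp: card_2_iff)
  have "N u \<subseteq> N v \<or> N v \<subseteq> N u" using c.nested[of u v] ne uv by (auto simp: N_def)
  then obtain y z where yz: "Y - {a} = {y, z}" "y \<noteq> z" "N z \<subseteq> N y"
    using uv by (metis insert_commute)
  have Y: "Y = {a, y, z}" using yz a by auto
  have dist: "a \<noteq> y" "a \<noteq> z" "y \<noteq> z" using yz by auto
  obtain x where x: "x \<in> X" "E `` {x} = Y" using ex_full_vertex[OF ne] by auto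
  have sub: "x \<in> N z \<Longrightarrow> x \<in> X" "x \<in> N y \<Longrightarrow> x \<in> X" "x \<in> N z \<Longrightarrow> x \<in> N y" for x
    using NX yz(3) by auto
  have Nz: "N z \<noteq> {}" using x Y by (auto simp: N_def)
  have Ez: "N z \<noteq> X"
  proof
    assume "N z = X"
    then have "N v = X" if "v \<in> Y" for v using that yz(3) NX[of y] a Y by auto
    then have "X \<times> Y \<subseteq> E" by (auto simp: N_def)
    then have "E = X \<times> Y" using E by auto
    then have "card E = p * 3" using cards by (simp add: card_cartesian_product)
    then show False using m w by simp
  qed
  consider "N y = X" | "N y = N z" | "N y \<noteq> X" "N y \<noteq> N z" by blast
  then show ?thesis
  proof cases
    case 1
    let ?X = "\<lambda>i :: nat. if i = 1 then N z else X - N z" and ?Y = "\<lambda>i :: nat. if i = 1 then {a, y} else {z}"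
    have k: "{1..2} = {1, 2 :: nat}" by auto
    have U: "X = (\<Union>i\<in>{1..2}. ?X i)" "Y = (\<Union>i\<in>{1..2}. ?Y i)"
      unfolding k using NX[of z] Y by auto
    have "vertex_bipartition G 2 ?X ?Y"
      unfolding vertex_bipartition_def
    proof (intro conjI)
      show "bipartition G (\<Union>i\<in>{1..2}. ?X i) (\<Union>i\<in>{1..2}. ?Y i)" using b U by simp
    qed (use k Nz Ez sub 1 a dist adj Y in \<open>auto simp: disjoint_family_on_def\<close>)
    then show ?thesis using U by blast
  next
    case 2
    let ?X = "\<lambda>i :: nat. if i = 1 then N z else X - N z" and ?Y = "\<lambda>i :: nat. if i = 1 then {a} else {y, z}"
    have k: "{1..2} = {1, 2 :: nat}" by auto
    have U: "X = (\<Union>i\<in>{1..2}. ?X i)" "Y = (\<Union>i\<in>{1..2}. ?Y i)"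
      unfolding k using NX[of z] Y by auto
    have "vertex_bipartition G 2 ?X ?Y"
      unfolding vertex_bipartition_def
    proof (intro conjI)
      show "bipartition G (\<Union>i\<in>{1..2}. ?X i) (\<Union>i\<in>{1..2}. ?Y i)" using b U by simp
    qed (use k Nz Ez sub 2 a dist adj Y in \<open>auto simp: disjoint_family_on_def\<close>)
    then show ?thesis using U by blast
  next
    case 3
    let ?X = "\<lambda>i :: nat. if i = 1 then N z else if i = 2 then N y - N z else X - N y"
      and ?Y = "\<lambda>i :: nat. if i = 1 then {a} else if i = 2 then {y} else {z}"
    have k: "{1..3} = {1, 2, 3 :: nat}" by auto
    have U: "X = (\<Union>i\<in>{1..3}. ?X i)" "Y = (\<Union>i\<in>{1..3}. ?Y i)"
      unfolding k using NX[of z] NX[of y] Y by auto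
    have "vertex_bipartition G 3 ?X ?Y"
      unfolding vertex_bipartition_def
    proof (intro conjI)
      show "bipartition G (\<Union>i\<in>{1..3}. ?X i) (\<Union>i\<in>{1..3}. ?Y i)" using b U by simp
    qed (use k Nz Ez sub 3 a dist adj Y in \<open>auto simp: disjoint_family_on_def\<close>)
    then show ?thesis using U by blast
  qed
qed

end

section \<open>Return to the parameters \<open>n\<close> and \<open>m\<close>\<close>

lemma optimal_in_rangeI:
  assumes n: "n > 6" and m: "2 * (int n - 2) < int m" "int m < 3 * (int n - 3)"
    and o: "bipartite_optimal n m G" and b: "bipartition G X Y" and le: "card Y \<le> card X"
  shows "optimal_in_range X Y (parcs G \<inter> X \<times> Y) (n - 3) (m - 2 * (n - 3))"
proof -
  interpret optimal_bip X Y "parcs G \<inter> X \<times> Y" by (rule optimal_bipI(1)[OF o _ b]) (use n in simp)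
  show ?thesis
    by unfold_locales (use optimal_bipI(2,3)[OF o _ b] n m le in auto)
qed

lemma bipartition_commute: "bipartition G X Y \<longleftrightarrow> bipartition G Y X"
  unfolding bipartition_def by blast

theorem theorem5p3:
  fixes n m :: nat and G :: "'a pair_pre_digraph"
  assumes "n > 6"
    and "2 * (int n - 2) < int m" and "int m < 3 * (int n - 3)"
    and "bipartite_optimal n m G"
  shows "difference_graph G \<and>
    (\<exists>xs ys. vertex_eigenvector G xs ys \<and> sum_list xs \<ge> sum_list ys) \<and>
    (\<forall>xs ys. vertex_eigenvector G xs ys \<and> sum_list xs \<ge> sum_list ys \<longrightarrow>
       optimal_vector n m (map real xs) (map real ys))"
proof -
  have pg: "pair_graph G" and "bipartite G"
    using assms(4) by (auto simp: bipartite_optimal_def conn_bipartite_graphs_def)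
  then obtain X Y where b: "bipartition G X Y" "card Y \<le> card X"
    unfolding bipartite_def by (meson bipartition_commute le_cases)
  interpret o: optimal_in_range X Y "parcs G \<inter> X \<times> Y" "n - 3" "m - 2 * (n - 3)"
    by (rule optimal_in_rangeI[OF assms b])
  have eq: "n - 3 + 3 = n" "2 * (n - 3) + (m - 2 * (n - 3)) = m" using assms(1-3) by auto
  have sums: "sum_list (map (\<lambda>i. card (X' i)) [1..<k + 1]) = card (\<Union>i\<in>{1..k}. X' i)"
    "sum_list (map (\<lambda>i. card (Y' i)) [1..<k + 1]) = card (\<Union>i\<in>{1..k}. Y' i)"
    if vb: "vertex_bipartition G k X' Y'" for k X' Y'
  proof -
    have "bipartition G (\<Union>i\<in>{1..k}. X' i) (\<Union>i\<in>{1..k}. Y' i)"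
      using vb by (simp add: vertex_bipartition_def)
    note fin = graph_eq_bip(2,3)[OF pg this]
    have "finite (X' i)" "finite (Y' i)" if "i \<in> {1..k}" for i
      using fin that by (auto intro: finite_subset)
    then show "sum_list (map (\<lambda>i. card (X' i)) [1..<k + 1]) = card (\<Union>i\<in>{1..k}. X' i)"
      "sum_list (map (\<lambda>i. card (Y' i)) [1..<k + 1]) = card (\<Union>i\<in>{1..k}. Y' i)"
      using vb sum_list_card_UN unfolding vertex_bipartition_def by blast+
  qed
  have "difference_graph G"
    unfolding difference_graph_def
  proof (intro conjI exI ballI)
    fix u v assume uv: "u \<in> X" "v \<in> X"
    have nb: "nbhd G x = (parcs G \<inter> X \<times> Y) `` {x}" if "x \<in> X" for x
      using that b(1) unfolding nbhd_def bipartition_def by blast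
    show "nbhd G u \<subseteq> nbhd G v \<or> nbhd G v \<subseteq> nbhd G u"
      unfolding nb[OF uv(1)] nb[OF uv(2)] by (rule o.nested[OF o.ne uv])
  qed (rule pg b(1))+
  \<comment> \<open>Existence keeps the universal statement that follows from being vacuous.\<close>
  moreover have "\<exists>xs ys. vertex_eigenvector G xs ys \<and> sum_list xs \<ge> sum_list ys"
  proof -
    obtain k X' Y' where vb: "vertex_bipartition G k X' Y'"
      and XY: "X = (\<Union>i\<in>{1..k}. X' i)" "Y = (\<Union>j\<in>{1..k}. Y' j)"
      using o.ex_vertex_bipartition[OF b(1) refl] by (elim exE conjE) (rule that)
    let ?xs = "map (\<lambda>i. card (X' i)) [1..<k + 1]" and ?ys = "map (\<lambda>i. card (Y' i)) [1..<k + 1]"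
    have "vertex_eigenvector G ?xs ?ys"
      unfolding vertex_eigenvector_def by (intro exI conjI) (rule vb refl)+
    moreover have "sum_list ?ys \<le> sum_list ?xs"
      unfolding sums[OF vb] XY[symmetric] by (rule b(2))
    ultimately show ?thesis by (intro exI conjI)
  qed
  moreover have "optimal_vector n m (map real xs) (map real ys)"
    if ve: "vertex_eigenvector G xs ys" and le: "sum_list xs \<ge> sum_list ys" for xs ys
  proof -
    obtain k X' Y' where vb: "vertex_bipartition G k X' Y'"
      and xs: "xs = map (\<lambda>i. card (X' i)) [1..<k + 1]" "ys = map (\<lambda>i. card (Y' i)) [1..<k + 1]"
      using ve unfolding vertex_eigenvector_def by (elim exE conjE) (rule that)
    let ?X = "\<Union>i\<in>{1..k}. X' i" and ?Y = "\<Union>j\<in>{1..k}. Y' j"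
    have b': "bipartition G ?X ?Y" using vb by (simp add: vertex_bipartition_def)
    have "card ?Y \<le> card ?X" using le sums[OF vb] xs by simp
    \<comment> \<open>The sides of an arbitrary vertex bipartition are not assumed to be the
      \<open>X\<close> and \<open>Y\<close> chosen above; instantiating the analysis anew avoids
      proving that the bipartition is unique.\<close>
    then interpret o': optimal_in_range ?X ?Y "parcs G \<inter> ?X \<times> ?Y" "n - 3" "m - 2 * (n - 3)"
      by (rule optimal_in_rangeI[OF assms b'])
    show ?thesis
      using o'.optimal_vector_vertex_bipartition[OF vb refl refl refl] unfolding eq xs .
  qed
  ultimately show ?thesis by blast
qed

end
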